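(* Let $M$ be a pointed metric space with at least two points. (i) If there exists a countable set of strongly exposed points of $B_{\mathcal{F}(M)}$ which separates $\operatorname{Lip}_0(M)$, then $\operatorname{Lip}_0(M)$ has the BCP. (ii) If $\mathcal{F}(M)$ has the Radon-Nikodým property, then $\operatorname{Lip}_0(M)$ has the BCP if and only if there exists a countable set of strongly exposed points of $B_{\mathcal{F}(M)}$ separating $\operatorname{Lip}_0(M)$.
   Context: $(M,d)$ is a metric space with a distinguished point $0$. $\operatorname{Lip}_0(M)$ is the space of Lipschitz functions $f:M\to\mathbb{R}$ with $f(0)=0$, normed by $\|f\|_L=\sup\{|f(t)-f(s)|/d(t,s):t\ne s\}$. The Lipschitz-free space is $\mathcal{F}(M)=\overline{\operatorname{span}}\{\delta_t:t\in M\}\subseteq\operatorname{Lip}_0(M)^*$, $\delta_t(f)=f(t)$; its dual is identified isometrically with $\operatorname{Lip}_0(M)$. A set $D\subset\mathcal{F}(M)$ separates $\operatorname{Lip}_0(M)=\mathcal{F}(M)^*$ if $f\in\operatorname{Lip}_0(M)$ and $f(\mu)=0$ for all $\mu\in D$ imply $f=0$. A point $x\in S_{\mathbb{X}}$ is a strongly exposed point of the closed unit ball $B_{\mathbb{X}}$ if there is $x^*\in S_{\mathbb{X}^*}$ with $x^*(x)=1$ such that for every sequence $\{x_n\}\subset B_{\mathbb{X}}$, $x^*(x_n)\to1$ implies $x_n\to x$ in norm. A normed space $\mathbb{Z}$ has the Ball Covering Property (BCP) if there are $z_n\in\mathbb{Z}\setminus\{0\}$ and $0<r_n\le\|z_n\|$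 ($n\in\mathbb{N}$) such that the unit sphere $S_{\mathbb{Z}}$ is contained in $\bigcup_n B(z_n,r_n)$, where $B(z,r)$ is the open ball of center $z$ and radius $r$. *)

theory Defs
  imports "HOL-Analysis.Analysis"
begin

text \<open>A pointed metric space is a type of sort \<open>{metric_space, zero}\<close>. The constant \<open>0\<close> is the
  distinguished point, and no law relates it to the metric.\<close>

subsection \<open>The space of Lipschitz functions vanishing at the distinguished point\<close>

typedef (overloaded) 'a lip0 =
  "{f :: 'a::{metric_space, zero} \<Rightarrow> real. f 0 = 0 \<and> (\<exists>L. L-lipschitz_on UNIV f)}"
  morphisms lip_apply Abs_lip0
  by (rule exI[of _ "\<lambda>_. 0"]) (auto intro!: exI[of _ 0] simp: lipschitz_on_def)

setup_lifting type_definition_lip0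

lemma lip0_eqI: "(\<And>t. lip_apply f t = lip_apply g t) \<Longrightarrow> f = g"
  by (simp add: lip_apply_inject[symmetric] fun_eq_iff)

lemma lip_apply_lipschitz: "\<exists>L. L-lipschitz_on UNIV (lip_apply f)"
  using lip_apply[of f] by simp

instantiation lip0 :: ("{metric_space, zero}") real_vector
begin

lift_definition zero_lip0 :: "'a lip0" is "\<lambda>_. 0"
  by (auto intro!: exI[of _ 0] simp: lipschitz_on_def)

lift_definition plus_lip0 :: "'a lip0 \<Rightarrow> 'a lip0 \<Rightarrow> 'a lip0" is "\<lambda>f g t. f t + g t"
  by (auto intro: lipschitz_on_add)

lift_definition uminus_lip0 :: "'a lip0 \<Rightarrow> 'a lip0" is "\<lambda>f t. - f t"
  by (auto intro: lipschitz_on_minus)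

lift_definition minus_lip0 :: "'a lip0 \<Rightarrow> 'a lip0 \<Rightarrow> 'a lip0" is "\<lambda>f g t. f t - g t"
  by (auto intro: lipschitz_on_diff)

lift_definition scaleR_lip0 :: "real \<Rightarrow> 'a lip0 \<Rightarrow> 'a lip0" is "\<lambda>c f t. c * f t"
  by (auto intro: lipschitz_on_cmult_real)

instance
  by standard (transfer; simp add: fun_eq_iff algebra_simps)+

end

lemmas lip_apply_simps [simp] = zero_lip0.rep_eq plus_lip0.rep_eq uminus_lip0.rep_eq
  minus_lip0.rep_eq scaleR_lip0.rep_eq

text \<open>The added \<open>0\<close> only matters for a one-point space, where there is no difference quotient.\<close>

definition lip_quotients :: "'a::{metric_space, zero} lip0 \<Rightarrow> real set" where
  "lip_quotients f = insert 0 {\<bar>lip_apply f t - lip_apply f s\<bar> / dist t s | t s. t \<noteq> s}"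

lemma bdd_above_lip_quotients: "bdd_above (lip_quotients f)"
proof -
  obtain L where L: "L-lipschitz_on UNIV (lip_apply f)"
    using lip_apply_lipschitz by blast
  have "q \<le> L" if "q \<in> lip_quotients f" for q
    using that L by (auto simp: lip_quotients_def lipschitz_on_def dist_real_def divide_le_eq)
  then show ?thesis by (rule bdd_aboveI)
qed

instantiation lip0 :: ("{metric_space, zero}") real_normed_vector
begin

definition norm_lip0 :: "'a lip0 \<Rightarrow> real" where
  "norm_lip0 f = Sup (lip_quotients f)"

definition dist_lip0 :: "'a lip0 \<Rightarrow> 'a lip0 \<Rightarrow> real" where
  "dist_lip0 f g = norm (f - g)"

definition sgn_lip0 :: "'a lip0 \<Rightarrow> 'a lip0" where
  "sgn_lip0 f = inverse (norm f) *\<^sub>R f"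

definition uniformity_lip0 :: "('a lip0 \<times> 'a lip0) filter" where
  "uniformity_lip0 = (INF e\<in>{0 <..}. principal {(f, g). dist f g < e})"

definition open_lip0 :: "'a lip0 set \<Rightarrow> bool" where
  "open_lip0 U \<longleftrightarrow> (\<forall>f\<in>U. \<forall>\<^sub>F (f', g) in uniformity. f' = f \<longrightarrow> g \<in> U)"

lemma norm_lip0_nonneg: "0 \<le> norm (f :: 'a lip0)"
  unfolding norm_lip0_def
  by (rule cSup_upper[OF _ bdd_above_lip_quotients]) (simp add: lip_quotients_def)

lemma lip_apply_diff_le: "\<bar>lip_apply f t - lip_apply f s\<bar> \<le> norm f * dist t s"
proof (cases "t = s")
  case False
  then have "\<bar>lip_apply f t - lip_apply f s\<bar> / dist t s \<in> lip_quotients f"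
    unfolding lip_quotients_def by blast
  then have "\<bar>lip_apply f t - lip_apply f s\<bar> / dist t s \<le> norm f"
    unfolding norm_lip0_def by (rule cSup_upper[OF _ bdd_above_lip_quotients])
  then show ?thesis using False by (simp add: divide_le_eq)
qed simp

lemma norm_lip0_leI:
  assumes "0 \<le> C" "\<And>t s. \<bar>lip_apply f t - lip_apply f s\<bar> \<le> C * dist t s"
  shows "norm f \<le> C"
  unfolding norm_lip0_def
  by (rule cSup_least) (use assms in \<open>auto simp: lip_quotients_def divide_le_eq\<close>)

lemma lip_apply_base [simp]: "lip_apply f 0 = 0"
  using lip_apply[of f] by simp

instance
proof
  fix f g :: "'a lip0" and a :: real
  show "(norm f = 0) = (f = 0)"
  proof
    assume "norm f = 0"
    then have "\<bar>lip_apply f t\<bar> \<le> 0" for t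
      using lip_apply_diff_le[of f t 0] by simp
    then show "f = 0" by (intro lip0_eqI) simp
  next
    assume "f = 0"
    then show "norm f = 0"
      using norm_lip0_leI[of 0 f] norm_lip0_nonneg[of f] by simp
  qed
  show "norm (f + g) \<le> norm f + norm g"
  proof (rule norm_lip0_leI)
    fix t s
    show "\<bar>lip_apply (f + g) t - lip_apply (f + g) s\<bar> \<le> (norm f + norm g) * dist t s"
      using lip_apply_diff_le[of f t s] lip_apply_diff_le[of g t s]
      by (simp add: algebra_simps)
  qed (simp add: norm_lip0_nonneg)
  have scale: "norm (b *\<^sub>R h) \<le> \<bar>b\<bar> * norm h" for b and h :: "'a lip0"
  proof (rule norm_lip0_leI)
    fix t s
    show "\<bar>lip_apply (b *\<^sub>R h) t - lip_apply (b *\<^sub>R h) s\<bar> \<le> \<bar>b\<bar> * norm h * dist t s"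
      using mult_left_mono[OF lip_apply_diff_le[of h t s], of "\<bar>b\<bar>"]
      by (simp add: abs_mult[symmetric] algebra_simps)
  qed (simp add: norm_lip0_nonneg)
  show "norm (a *\<^sub>R f) = \<bar>a\<bar> * norm f"
  proof (cases "a = 0")
    case True
    then show ?thesis using scale[of a f] norm_lip0_nonneg[of "a *\<^sub>R f"] by simp
  next
    case False
    have "norm f \<le> \<bar>inverse a\<bar> * norm (a *\<^sub>R f)"
      using scale[of "inverse a" "a *\<^sub>R f"] False by simp
    then have "\<bar>a\<bar> * norm f \<le> norm (a *\<^sub>R f)"
      using False by (simp add: field_simps)
    with scale[of a f] show ?thesis by simp
  qed
qed (simp_all add: dist_lip0_def sgn_lip0_def uniformity_lip0_def open_lip0_def)

end

subsection \<open>The Lipschitz-free space\<close>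

lift_definition lip_delta :: "'a::{metric_space, zero} \<Rightarrow> 'a lip0 \<Rightarrow>\<^sub>L real" is
  "\<lambda>t f. lip_apply f t"
proof (rule bounded_linear_intro)
  fix t :: 'a and f :: "'a lip0"
  show "norm (lip_apply f t) \<le> norm f * dist t 0"
    using lip_apply_diff_le[of f t 0] by simp
qed simp_all

lemma subspace_closure:
  fixes S :: "'b::real_normed_vector set"
  assumes "subspace S"
  shows "subspace (closure S)"
proof (rule subspaceI)
  show "0 \<in> closure S"
    using assms closure_subset subspace_0 by blast
  show "x + y \<in> closure S" if xy: "x \<in> closure S" "y \<in> closure S" for x y
  proof -
    obtain u v where "\<forall>n. u n \<in> S" "u \<longlonglongrightarrow> x" "\<forall>n. v n \<in> S" "v \<longlonglongrightarrow> y"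
      using xy unfolding closure_sequential by blast
    then show ?thesis
      unfolding closure_sequential
      by (intro exI[of _ "\<lambda>n. u n + v n"]) (simp add: assms subspace_add tendsto_add)
  qed
  show "c *\<^sub>R x \<in> closure S" if x: "x \<in> closure S" for c x
  proof -
    obtain u where "\<forall>n. u n \<in> S" "u \<longlonglongrightarrow> x"
      using x unfolding closure_sequential by blast
    then show ?thesis
      unfolding closure_sequential
      by (intro exI[of _ "\<lambda>n. c *\<^sub>R u n"]) (simp add: assms subspace_scale tendsto_scaleR)
  qed
qed

typedef (overloaded) 'a lip_free =
  "closure (span (range (lip_delta :: 'a::{metric_space, zero} \<Rightarrow> 'a lip0 \<Rightarrow>\<^sub>L real)))"
  morphisms free_functional Abs_lip_free
  using closure_subset span_zero by blast

setup_lifting type_definition_lip_free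

instantiation lip_free :: ("{metric_space, zero}") real_normed_vector
begin

lift_definition zero_lip_free :: "'a lip_free" is 0
  by (simp add: subspace_0 subspace_closure)

lift_definition plus_lip_free :: "'a lip_free \<Rightarrow> 'a lip_free \<Rightarrow> 'a lip_free" is "(+)"
  by (simp add: subspace_add subspace_closure)

lift_definition uminus_lip_free :: "'a lip_free \<Rightarrow> 'a lip_free" is uminus
  by (simp add: subspace_neg subspace_closure)

lift_definition minus_lip_free :: "'a lip_free \<Rightarrow> 'a lip_free \<Rightarrow> 'a lip_free" is "(-)"
  by (simp add: subspace_diff subspace_closure)

lift_definition scaleR_lip_free :: "real \<Rightarrow> 'a lip_free \<Rightarrow> 'a lip_free" is "(*\<^sub>R)"
  by (simp add: subspace_scale subspace_closure)

lift_definition norm_lip_free :: "'a lip_free \<Rightarrow> real" is norm .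

lift_definition dist_lip_free :: "'a lip_free \<Rightarrow> 'a lip_free \<Rightarrow> real" is dist .

lift_definition sgn_lip_free :: "'a lip_free \<Rightarrow> 'a lip_free" is sgn
  by (simp add: sgn_div_norm subspace_scale subspace_closure)

definition uniformity_lip_free :: "('a lip_free \<times> 'a lip_free) filter" where
  "uniformity_lip_free = (INF e\<in>{0 <..}. principal {(\<mu>, \<nu>). dist \<mu> \<nu> < e})"

definition open_lip_free :: "'a lip_free set \<Rightarrow> bool" where
  "open_lip_free U \<longleftrightarrow> (\<forall>\<mu>\<in>U. \<forall>\<^sub>F (\<mu>', \<nu>) in uniformity. \<mu>' = \<mu> \<longrightarrow> \<nu> \<in> U)"

instance
proof
  fix \<mu> \<nu> \<xi> :: "'a lip_free" and a b :: real and U :: "'a lip_free set"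
  show "\<mu> + \<nu> + \<xi> = \<mu> + (\<nu> + \<xi>)" by transfer (rule add.assoc)
  show "\<mu> + \<nu> = \<nu> + \<mu>" by transfer (rule add.commute)
  show "0 + \<mu> = \<mu>" by transfer (rule add_0)
  show "- \<mu> + \<mu> = 0" by transfer (rule left_minus)
  show "\<mu> - \<nu> = \<mu> + - \<nu>" by transfer (rule diff_conv_add_uminus)
  show "a *\<^sub>R (\<mu> + \<nu>) = a *\<^sub>R \<mu> + a *\<^sub>R \<nu>" by transfer (rule scaleR_add_right)
  show "(a + b) *\<^sub>R \<mu> = a *\<^sub>R \<mu> + b *\<^sub>R \<mu>" by transfer (rule scaleR_add_left)
  show "a *\<^sub>R b *\<^sub>R \<mu> = (a * b) *\<^sub>R \<mu>" by transfer (rule scaleR_scaleR)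
  show "1 *\<^sub>R \<mu> = \<mu>" by transfer (rule scaleR_one)
  show "dist \<mu> \<nu> = norm (\<mu> - \<nu>)" by transfer (rule dist_norm)
  show "sgn \<mu> = inverse (norm \<mu>) *\<^sub>R \<mu>" by transfer (rule sgn_div_norm)
  show "(norm \<mu> = 0) = (\<mu> = 0)" by transfer (rule norm_eq_zero)
  show "norm (\<mu> + \<nu>) \<le> norm \<mu> + norm \<nu>" by transfer (rule norm_triangle_ineq)
  show "norm (a *\<^sub>R \<mu>) = \<bar>a\<bar> * norm \<mu>" by transfer (rule norm_scaleR)
  show "uniformity = (INF e\<in>{0 <..}. principal {(\<mu>, \<nu> :: 'a lip_free). dist \<mu> \<nu> < e})"
    by (rule uniformity_lip_free_def)
  show "open U = (\<forall>\<mu>\<in>U. \<forall>\<^sub>F (\<mu>', \<nu>) in uniformity. \<mu>' = \<mu> \<longrightarrow> \<nu> \<in> U)"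
    by (rule open_lip_free_def)
qed

end

instance lip_free :: ("{metric_space, zero}") banach
proof
  fix X :: "nat \<Rightarrow> 'a lip_free"
  let ?F = "closure (span (range (lip_delta :: 'a \<Rightarrow> 'a lip0 \<Rightarrow>\<^sub>L real)))"
  assume "Cauchy X"
  then have cauchy: "Cauchy (\<lambda>n. free_functional (X n))"
    by (simp add: Cauchy_def dist_lip_free.rep_eq)
  have complete: "complete ?F"
    by (simp add: complete_eq_closed)
  have mem: "\<forall>n. free_functional (X n) \<in> ?F"
    using free_functional by (intro allI)
  obtain l where l: "l \<in> ?F" "(\<lambda>n. free_functional (X n)) \<longlonglongrightarrow> l"
    by (rule completeE[OF complete mem cauchy])
  have "(\<lambda>n. dist (X n) (Abs_lip_free l)) \<longlonglongrightarrow> 0"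
    using iffD1[OF tendsto_dist_iff l(2)]
    by (simp only: dist_lip_free.rep_eq Abs_lip_free_inverse[OF l(1)])
  then have "X \<longlonglongrightarrow> Abs_lip_free l"
    by (rule iffD2[OF tendsto_dist_iff])
  then show "convergent X" by (rule convergentI)
qed

text \<open>The action of \<open>f\<close> on \<open>\<mu>\<close> in the duality between \<open>lip0\<close> and \<open>lip_free\<close> is
  \<open>blinfun_apply (free_functional \<mu>) f\<close>.\<close>

definition separates_lip0 :: "'a::{metric_space, zero} lip_free set \<Rightarrow> bool" where
  "separates_lip0 D \<longleftrightarrow>
    (\<forall>f. (\<forall>\<mu>\<in>D. blinfun_apply (free_functional \<mu>) f = 0) \<longrightarrow> f = 0)"

subsection \<open>Geometry of normed spaces\<close>

definition strongly_exposed_point :: "'x::real_normed_vector \<Rightarrow> bool" where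
  "strongly_exposed_point x \<longleftrightarrow> x \<in> sphere 0 1 \<and>
    (\<exists>\<phi> :: 'x \<Rightarrow>\<^sub>L real. \<phi> \<in> sphere 0 1 \<and> blinfun_apply \<phi> x = 1 \<and>
      (\<forall>X :: nat \<Rightarrow> 'x. range X \<subseteq> cball 0 1 \<longrightarrow>
        (\<lambda>n. blinfun_apply \<phi> (X n)) \<longlonglongrightarrow> 1 \<longrightarrow> X \<longlonglongrightarrow> x))"

definition ball_covering_property :: "'z::real_normed_vector itself \<Rightarrow> bool" where
  "ball_covering_property _ \<longleftrightarrow>
    (\<exists>(z :: nat \<Rightarrow> 'z) (r :: nat \<Rightarrow> real).
      (\<forall>n. z n \<noteq> 0 \<and> 0 < r n \<and> r n \<le> norm (z n)) \<and> sphere 0 1 \<subseteq> (\<Union>n. ball (z n) (r n)))"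

subsection \<open>The Radon-Nikodym property\<close>

definition vector_measure :: "'w measure \<Rightarrow> ('w set \<Rightarrow> 'x::real_normed_vector) \<Rightarrow> bool" where
  "vector_measure M G \<longleftrightarrow>
    (\<forall>A :: nat \<Rightarrow> 'w set. range A \<subseteq> sets M \<longrightarrow> disjoint_family A \<longrightarrow>
      (\<lambda>i. G (A i)) sums G (\<Union>i. A i))"

definition bounded_variation_measure ::
    "'w measure \<Rightarrow> ('w set \<Rightarrow> 'x::real_normed_vector) \<Rightarrow> bool" where
  "bounded_variation_measure M G \<longleftrightarrow>
    (\<exists>C. \<forall>P. finite P \<longrightarrow> P \<subseteq> sets M \<longrightarrow> partition_on (space M) P \<longrightarrow>
      (\<Sum>E\<in>P. norm (G E)) \<le> C)"

definition continuous_wrt_measure ::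
    "'w measure \<Rightarrow> ('w set \<Rightarrow> 'x::real_normed_vector) \<Rightarrow> bool" where
  "continuous_wrt_measure M G \<longleftrightarrow>
    (\<forall>\<epsilon>>0. \<exists>\<delta>>0. \<forall>E\<in>sets M. measure M E < \<delta> \<longrightarrow> norm (G E) < \<epsilon>)"

text \<open>This repeats the introduction rule of \<^const>\<open>has_bochner_integral\<close>, whose type requires a
  second countable target, which excludes nonseparable spaces. Here strong measurability of
  \<open>g\<close> is enforced by the approximation in mean by simple functions.\<close>

definition has_strong_bochner_integral ::
    "'w measure \<Rightarrow> ('w \<Rightarrow> 'x::real_normed_vector) \<Rightarrow> 'x \<Rightarrow> bool" where
  "has_strong_bochner_integral M g x \<longleftrightarrow> g \<in> borel_measurable M \<and>
    (\<exists>s. (\<forall>i::nat. Bochner_Integration.simple_bochner_integrable M (s i)) \<and>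
      (\<lambda>i. \<integral>\<^sup>+w. norm (g w - s i w) \<partial>M) \<longlonglongrightarrow> 0 \<and>
      (\<lambda>i. Bochner_Integration.simple_bochner_integral M (s i)) \<longlonglongrightarrow> x)"

definition radon_nikodym_property_wrt :: "'w measure \<Rightarrow> 'x::banach itself \<Rightarrow> bool" where
  "radon_nikodym_property_wrt M _ \<longleftrightarrow>
    (\<forall>G :: 'w set \<Rightarrow> 'x.
      vector_measure M G \<longrightarrow> bounded_variation_measure M G \<longrightarrow> continuous_wrt_measure M G \<longrightarrow>
      (\<exists>g. \<forall>E\<in>sets M. has_strong_bochner_integral M (\<lambda>w. indicator E w *\<^sub>R g w) (G E)))"

text \<open>HOL cannot quantify over all types, so the underlying set of the finite measure space is a
  set of reals, with an arbitrary \<open>\<sigma>\<close>-algebra on it. This loses nothing: Lebesgue measure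
  on the unit interval is among these spaces and already decides the property.\<close>

definition radon_nikodym_property :: "'x::banach itself \<Rightarrow> bool" where
  "radon_nikodym_property X \<longleftrightarrow>
    (\<forall>M :: real measure. finite_measure M \<longrightarrow> radon_nikodym_property_wrt M X)"

end

theory Submission
  imports Defs "HOL-Probability.Conditional_Expectation"
begin

text \<open>The statement is about a Banach space \<open>X\<close>, here the Lipschitz-free space, and its dual; the pairing
\<open>free_pairing\<close> identifies the space of Lipschitz functions isometrically with the dual of the free
space, and the rest of the argument is valid for every Banach space.

If \<open>\<phi>\<close> strongly exposes \<open>x\<close> and \<open>f\<close> is a unit functional with \<open>f x > 0\<close>, then a large multiple \<open>k \<phi>\<close> has distance
less than \<open>k\<close> from \<open>f\<close>: near \<open>x\<close> the functional \<open>f\<close> takes away a fixed amount from \<open>k \<phi>\<close>, and far from \<open>x\<close> the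
values of \<open>k \<phi>\<close> are already much smaller than \<open>k\<close> (\<open>exposing_multiple_close\<close>). So the balls of radius
\<open>\<bar>i\<bar>\<close> about \<open>i \<phi>\<close>, for nonzero integers \<open>i\<close> and the functionals \<open>\<phi>\<close> exposing the points of a countable separating
set, cover the unit sphere.

Conversely, if a functional \<open>z\<close> attains its norm at \<open>x\<close>, then each \<open>f\<close> with \<open>norm (z - f) < norm z\<close> is positive at
\<open>x\<close>. If the centres of a covering sequence of balls were strongly exposing, their exposed points
would thus separate. In general the centres are only limits of strongly exposing functionals, and
this is enough because the inequality is strict. Here the Radon-Nikodym property enters: it makes the
strongly exposing functionals dense (\<open>dense_strongly_exposing\<close>).

For the density, Baire's theorem leaves only to show that the functionals having a slice of small
diameter are dense. Suppose that all functionals near \<open>f\<close> have large slices only. A point that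
almost maximises such a functional is then almost a convex combination of points of the same kind
that are far away from it (\<open>near_maximizer_branches\<close>, by Hahn-Banach separation). Iterating gives a
bush, a bounded approximate martingale on the unit interval whose steps do not become small. Its
integrals converge to a vector measure of bounded variation that is dominated by Lebesgue measure
and has no density (\<open>no_density\<close>), which the Radon-Nikodym property excludes.\<close>

section \<open>Hahn-Banach separation in normed spaces\<close>

definition sublinear :: "('x::real_vector \<Rightarrow> real) \<Rightarrow> bool" where
  "sublinear p \<longleftrightarrow> (\<forall>u v. p (u + v) \<le> p u + p v) \<and> (\<forall>c\<ge>0. \<forall>v. p (c *\<^sub>R v) = c * p v)"

lemma sublinear_add: "sublinear p \<Longrightarrow> p (u + v) \<le> p u + p v"
  and sublinear_scale: "sublinear p \<Longrightarrow> 0 \<le> c \<Longrightarrow> p (c *\<^sub>R v) = c * p v"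
  by (auto simp: sublinear_def)

lemma sublinear_zero: "sublinear p \<Longrightarrow> p 0 = 0"
  using sublinear_scale[of p 0 0] by simp

lemma sublinear_minus_le: "sublinear p \<Longrightarrow> - p (- v) \<le> p v"
  using sublinear_add[of p v "- v"] by (simp add: sublinear_zero)

lemma sublinearI:
  assumes "\<And>u v. p (u + v) \<le> p u + p v" and "\<And>c v. c > 0 \<Longrightarrow> p (c *\<^sub>R v) \<le> c * p v" and "p 0 = 0"
  shows "sublinear p"
  unfolding sublinear_def
proof (intro conjI allI impI)
  fix c :: real and v assume "c \<ge> 0"
  show "p (c *\<^sub>R v) = c * p v"
  proof (cases "c = 0")
    case False
    then have c: "c > 0" using \<open>c \<ge> 0\<close> by simp
    have "p v \<le> inverse c * p (c *\<^sub>R v)"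
      using assms(2)[of "inverse c" "c *\<^sub>R v"] c by simp
    then have "c * p v \<le> p (c *\<^sub>R v)" using c by (simp add: field_simps)
    then show ?thesis using assms(2)[OF c, of v] by simp
  qed (use assms(3) in simp)
qed (rule assms(1))

text \<open>Every \<open>q \<le> p\<close> in the chain satisfies \<open>q v \<ge> - p (- v)\<close>, so the infimum is finite; it is subadditive
because of any two members of a chain one is the smaller at both arguments.\<close>
lemma sublinear_INF_chain:
  fixes p :: "'x::real_vector \<Rightarrow> real"
  assumes "C \<noteq> {}" and C_ball: "\<forall>q\<in>C. sublinear q \<and> q \<le> p"
    and chain: "\<forall>q\<in>C. \<forall>r\<in>C. q \<le> r \<or> r \<le> q"
  shows "sublinear (\<lambda>v. INF q\<in>C. q v)" and "q \<in> C \<Longrightarrow> (INF q\<in>C. q v) \<le> q v"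
proof -
  have C: "sublinear q" "q \<le> p" if "q \<in> C" for q
    using C_ball that by auto
  have "- p (- v) \<le> q v" if "q \<in> C" for q v
    using sublinear_minus_le[OF C(1)[OF that], of v] le_funD[OF C(2)[OF that], of "- v"] by linarith
  then have bdd: "bdd_below ((\<lambda>q. q v) ` C)" for v by (auto intro!: bdd_belowI)
  show low: "(INF q\<in>C. q v) \<le> q v" if "q \<in> C" for q v
    by (rule cINF_lower[OF bdd that])
  show "sublinear (\<lambda>v. INF q\<in>C. q v)"
  proof (rule sublinearI)
    fix u v
    have "(INF q\<in>C. q (u + v)) \<le> q u + r v" if qr: "q \<in> C" "r \<in> C" for q r
    proof -
      obtain s where s: "s \<in> C" "s u \<le> q u" "s v \<le> r v"
        using bspec[OF bspec[OF chain qr(1)] qr(2)] qr by (meson le_funD order_refl)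
      have "(INF q\<in>C. q (u + v)) \<le> s u + s v"
        by (rule order_trans[OF low[OF s(1)] sublinear_add[OF C(1)[OF s(1)]]])
      then show ?thesis using s by linarith
    qed
    then have "(INF q\<in>C. q (u + v)) - r v \<le> (INF q\<in>C. q u)" if "r \<in> C" for r
      using that assms(1) by (intro cINF_greatest) (auto simp: algebra_simps)
    then have "(INF q\<in>C. q (u + v)) - (INF q\<in>C. q u) \<le> (INF q\<in>C. q v)"
      using assms(1) by (intro cINF_greatest) (auto simp: algebra_simps)
    then show "(INF q\<in>C. q (u + v)) \<le> (INF q\<in>C. q u) + (INF q\<in>C. q v)" by simp
  next
    fix c :: real and v assume c: "c > 0"
    have "(INF q\<in>C. q (c *\<^sub>R v)) / c \<le> q v" if "q \<in> C" for q
      using low[OF that, of "c *\<^sub>R v"] C[OF that] c by (simp add: sublinear_scale field_simps)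
    then have "(INF q\<in>C. q (c *\<^sub>R v)) / c \<le> (INF q\<in>C. q v)"
      using assms(1) by (intro cINF_greatest) auto
    then show "(INF q\<in>C. q (c *\<^sub>R v)) \<le> c * (INF q\<in>C. q v)"
      using c by (simp add: field_simps)
  next
    have "(\<lambda>q. q 0) ` C = {0}"
      using assms(1) C sublinear_zero by force
    then show "(INF q\<in>C. q 0) = 0" by simp
  qed
qed

text \<open>If \<open>q\<close> is not odd at \<open>a\<close>, it can be lowered: \<open>r\<close> is the largest sublinear functional below \<open>q\<close>
that takes at most the value \<open>- q a\<close> at \<open>- a\<close>. Hence a minimal sublinear functional is odd.\<close>
lemma sublinear_improve:
  fixes q :: "'x::real_vector \<Rightarrow> real" and a :: 'x
  assumes q: "sublinear q"
  defines "r \<equiv> \<lambda>v. INF t\<in>{0..}. q (v + t *\<^sub>R a) - t * q a"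
  shows "sublinear r" and "r \<le> q" and "r (- a) \<le> - q a"
proof -
  have "- q (- v) \<le> q (v + t *\<^sub>R a) - t * q a" if "t \<ge> 0" for t v
    using sublinear_add[OF q, of "v + t *\<^sub>R a" "- v"] sublinear_scale[OF q that, of a] by simp
  then have bdd: "bdd_below ((\<lambda>t. q (v + t *\<^sub>R a) - t * q a) ` {0..})" for v
    by (auto intro!: bdd_belowI)
  have low: "r v \<le> q (v + t *\<^sub>R a) - t * q a" if "t \<ge> 0" for t v
    unfolding r_def using that by (intro cINF_lower bdd) simp
  have great: "b \<le> r v" if "\<And>t. t \<ge> 0 \<Longrightarrow> b \<le> q (v + t *\<^sub>R a) - t * q a" for b v
    unfolding r_def using that by (intro cINF_greatest) auto
  show "r \<le> q" using low[of 0] by (auto intro!: le_funI)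
  show "r (- a) \<le> - q a" using low[of 1 "- a"] by (simp add: sublinear_zero[OF q])
  show "sublinear r"
  proof (rule sublinearI)
    fix u v
    have "r (u + v) \<le> (q (u + s *\<^sub>R a) - s * q a) + (q (v + t *\<^sub>R a) - t * q a)" if "s \<ge> 0" "t \<ge> 0" for s t
      using low[of "s + t" "u + v"] sublinear_add[OF q, of "u + s *\<^sub>R a" "v + t *\<^sub>R a"] that
      by (simp add: algebra_simps)
    then have "r (u + v) - (q (v + t *\<^sub>R a) - t * q a) \<le> r u" if "t \<ge> 0" for t
      using that by (intro great) (simp add: algebra_simps)
    then have "r (u + v) - r u \<le> r v"
      by (intro great) (simp add: algebra_simps)
    then show "r (u + v) \<le> r u + r v" by simp
  next
    fix c :: real and v assume c: "c > 0"
    have "r (c *\<^sub>R v) / c \<le> r v"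
    proof (rule great)
      fix t :: real assume t: "t \<ge> 0"
      have "q (c *\<^sub>R v + (c * t) *\<^sub>R a) = c * q (v + t *\<^sub>R a)"
        using sublinear_scale[OF q, of c "v + t *\<^sub>R a"] c by (simp add: scaleR_add_right)
      then show "r (c *\<^sub>R v) / c \<le> q (v + t *\<^sub>R a) - t * q a"
        using low[of "c * t" "c *\<^sub>R v"] t c by (simp add: field_simps)
    qed
    then show "r (c *\<^sub>R v) \<le> c * r v" using c by (simp add: field_simps)
  next
    have "r 0 \<le> 0" using low[of 0 0] by (simp add: sublinear_zero[OF q])
    moreover have "0 \<le> r 0"
      by (rule great) (simp add: sublinear_scale[OF q])
    ultimately show "r 0 = 0" by simp
  qed
qed

text \<open>The Hahn-Banach theorem in the form of Zorn's lemma for sublinear functionals: a minimal one below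
\<open>p\<close> is odd, and an odd sublinear functional is additive.\<close>
theorem sublinear_dominates_linear:
  fixes p :: "'x::real_vector \<Rightarrow> real"
  assumes p: "sublinear p"
  obtains h where "linear h" "h \<le> p"
proof -
  let ?A = "{q. sublinear q \<and> q \<le> p}"
  have "\<exists>m\<in>?A. \<forall>q\<in>?A. q \<le> m \<longrightarrow> q = m"
  proof (rule predicate_Zorn)
    show "partial_order_on ?A (relation_of (\<lambda>q r. r \<le> q) ?A)"
      by (rule partial_order_on_relation_ofI) auto
    fix C assume C: "C \<in> Chains (relation_of (\<lambda>q r. r \<le> q) ?A)"
    show "\<exists>u\<in>?A. \<forall>q\<in>C. u \<le> q"
    proof (cases "C = {}")
      case False
      have CA: "\<forall>q\<in>C. sublinear q \<and> q \<le> p"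
        using C by (auto simp: Chains_def relation_of_def)
      have chain: "\<forall>q\<in>C. \<forall>r\<in>C. q \<le> r \<or> r \<le> q"
        using C by (auto simp: Chains_def relation_of_def)
      note inf = sublinear_INF_chain[OF False CA chain]
      obtain q where "q \<in> C" using False by blast
      then have "(\<lambda>v. INF q\<in>C. q v) \<le> p"
        using inf(2)[OF \<open>q \<in> C\<close>] bspec[OF CA \<open>q \<in> C\<close>] by (intro le_funI) (meson le_funD order_trans)
      then show ?thesis
        using inf by (intro bexI[of _ "\<lambda>v. INF q\<in>C. q v"]) (auto intro: le_funI)
    qed (use p in auto)
  qed
  then obtain m where m: "sublinear m" "m \<le> p"
    and min: "\<And>q. sublinear q \<Longrightarrow> q \<le> p \<Longrightarrow> q \<le> m \<Longrightarrow> q = m"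
    by blast
  have "m (- a) = - m a" for a
  proof -
    note imp = sublinear_improve[OF m(1), of a]
    have "m (- a) \<le> - m a"
      using fun_cong[OF min[OF imp(1) order_trans[OF imp(2) m(2)] imp(2)], of "- a"] imp(3)
      by linarith
    then show ?thesis using sublinear_minus_le[OF m(1), of a] by linarith
  qed
  note odd = this
  have "linear m"
  proof (rule linearI)
    fix u v
    have "- m (u + v) \<le> - m u + - m v"
      using sublinear_add[OF m(1), of "- u" "- v"] odd[of "u + v"] odd[of u] odd[of v] by simp
    then show "m (u + v) = m u + m v"
      using sublinear_add[OF m(1), of u v] by linarith
  next
    fix c :: real and v
    show "m (c *\<^sub>R v) = c *\<^sub>R m v"
    proof (cases "c \<ge> 0")
      case False
      then have "m ((- c) *\<^sub>R v) = (- c) * m v" by (intro sublinear_scale[OF m(1)]) simp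
      then show ?thesis using odd[of "c *\<^sub>R v"] by simp
    qed (simp add: sublinear_scale[OF m(1)])
  qed
  then show thesis using m(2) that by blast
qed

text \<open>Writing the requirements on \<open>h\<close> as upper bounds, namely \<open>h v \<le> norm v\<close> and \<open>h (k - x) \<le> - e\<close> for
\<open>k\<close> in \<open>K\<close>, the largest sublinear functional obeying them is the \<open>p\<close> below. Convexity of \<open>K\<close>
makes it subadditive and the distance \<open>e\<close> keeps it above \<open>- norm v\<close>; any linear functional
below it separates.\<close>
theorem separate_point_from_convex:
  fixes x :: "'x::real_normed_vector"
  assumes K: "convex K" "K \<noteq> {}" and dist: "\<And>k. k \<in> K \<Longrightarrow> e \<le> dist x k"
  obtains h :: "'x \<Rightarrow>\<^sub>L real" where "norm h \<le> 1" "\<And>k. k \<in> K \<Longrightarrow> blinfun_apply h k + e \<le> blinfun_apply h x"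
proof -
  let ?I = "{0::real..} \<times> K"
  define F where "F v = (\<lambda>(t, k). norm (v - t *\<^sub>R (k - x)) - t * e)" for v
  define p where "p v = (INF i\<in>?I. F v i)" for v
  have F_ge: "- norm v \<le> F v (t, k)" if "t \<ge> 0" "k \<in> K" for v t k
  proof -
    have "t * e \<le> norm (t *\<^sub>R (k - x))"
      using mult_left_mono[OF dist[OF that(2)] that(1)] that(1) by (simp add: dist_norm norm_minus_commute)
    then show ?thesis
      using norm_triangle_ineq2[of "t *\<^sub>R (k - x)" v]
      by (simp add: F_def norm_minus_commute)
  qed
  then have bdd: "bdd_below (F v ` ?I)" for v by (auto intro!: bdd_belowI)
  have low: "p v \<le> F v (t, k)" if "t \<ge> 0" "k \<in> K" for v t k
    unfolding p_def using that by (intro cINF_lower bdd) auto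
  have great: "b \<le> p v" if "\<And>t k. t \<ge> 0 \<Longrightarrow> k \<in> K \<Longrightarrow> b \<le> F v (t, k)" for b v
    unfolding p_def using that K(2) by (intro cINF_greatest) auto
  obtain k0 where k0: "k0 \<in> K" using K(2) by blast
  have p_norm: "p v \<le> norm v" for v using low[of 0 k0 v] k0 by (simp add: F_def)
  have p_K: "p (k - x) \<le> - e" if "k \<in> K" for k using low[of 1 k "k - x"] that by (simp add: F_def)
  have "sublinear p"
  proof (rule sublinearI)
    fix u v
    have comb: "p (u + v) \<le> F u (s, k) + F v (t, l)" if st: "s \<ge> 0" "t \<ge> 0" and kl: "k \<in> K" "l \<in> K" for s t k l
    proof (cases "s + t = 0")
      case True
      then have "s = 0" "t = 0" using st by auto
      then show ?thesis
        using low[of 0 k "u + v"] kl norm_triangle_ineq[of u v] by (simp add: F_def)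
    next
      case False
      define w where "w = (s / (s + t)) *\<^sub>R k + (t / (s + t)) *\<^sub>R l"
      have "s / (s + t) + t / (s + t) = 1" using False by (simp add: add_divide_distrib[symmetric])
      then have w: "w \<in> K"
        unfolding w_def using st by (intro convexD[OF K(1) kl]) auto
      have "(s + t) *\<^sub>R w = s *\<^sub>R k + t *\<^sub>R l"
        unfolding w_def using False by (simp add: scaleR_add_right)
      then have "(s + t) *\<^sub>R (w - x) = s *\<^sub>R (k - x) + t *\<^sub>R (l - x)"
        by (simp add: algebra_simps)
      then have "F (u + v) (s + t, w) = norm ((u - s *\<^sub>R (k - x)) + (v - t *\<^sub>R (l - x))) - (s + t) * e"
        by (simp add: F_def algebra_simps)
      also have "\<dots> \<le> F u (s, k) + F v (t, l)"
        using norm_triangle_ineq[of "u - s *\<^sub>R (k - x)" "v - t *\<^sub>R (l - x)"]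
        by (simp add: F_def algebra_simps)
      finally show ?thesis using low[of "s + t" w "u + v"] st w by simp
    qed
    then have "p (u + v) - F v (t, l) \<le> p u" if "t \<ge> 0" "l \<in> K" for t l
      using that by (intro great) (simp add: algebra_simps)
    then have "p (u + v) - p u \<le> p v"
      by (intro great) (simp add: algebra_simps)
    then show "p (u + v) \<le> p u + p v" by simp
  next
    fix c :: real and v assume c: "c > 0"
    have "p (c *\<^sub>R v) / c \<le> p v"
    proof (rule great)
      fix t :: real and k assume t: "t \<ge> 0" and k: "k \<in> K"
      have "c *\<^sub>R v - (c * t) *\<^sub>R (k - x) = c *\<^sub>R (v - t *\<^sub>R (k - x))"
        by (simp add: algebra_simps)
      then have "F (c *\<^sub>R v) (c * t, k) = c * F v (t, k)"
        using c by (simp add: F_def right_diff_distrib)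
      then show "p (c *\<^sub>R v) / c \<le> F v (t, k)"
        using low[of "c * t" k "c *\<^sub>R v"] t c k by (simp add: field_simps)
    qed
    then show "p (c *\<^sub>R v) \<le> c * p v" using c by (simp add: field_simps)
  next
    have "0 \<le> p 0" by (rule great) (use F_ge[where v = 0] in simp)
    then show "p 0 = 0" using p_norm[of 0] by simp
  qed
  then obtain h where h: "linear h" "h \<le> p" using sublinear_dominates_linear by blast
  have h_norm: "\<bar>h v\<bar> \<le> norm v" for v
  proof -
    have "h v \<le> norm v" "h (- v) \<le> norm (- v)"
      by (rule order_trans[OF le_funD[OF h(2)] p_norm])+
    then show ?thesis by (simp add: linear_neg[OF h(1)] abs_le_iff)
  qed
  have bl: "bounded_linear h"
    using h(1) h_norm by (auto intro!: bounded_linear_intro[of _ 1] simp: linear_add linear_scale)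
  have app: "blinfun_apply (Blinfun h) = h" by (rule bounded_linear_Blinfun_apply[OF bl])
  show thesis
  proof
    show "norm (Blinfun h) \<le> 1"
      by (rule norm_blinfun_bound) (use h_norm app in auto)
    show "blinfun_apply (Blinfun h) k + e \<le> blinfun_apply (Blinfun h) x" if "k \<in> K" for k
      using le_funD[OF h(2), of "k - x"] p_K[OF that] by (simp add: app linear_diff[OF h(1)])
  qed
qed

section \<open>Averages with equal weights\<close>

definition average :: "'x::real_vector list \<Rightarrow> 'x" where
  "average xs = (1 / real (length xs)) *\<^sub>R sum_list xs"

lemma sum_list_concat_replicate:
  "sum_list (concat (replicate k xs)) = real k *\<^sub>R (sum_list xs :: 'x::real_vector)"
  by (induction k) (simp_all add: scaleR_left_distrib)

lemma length_concat_replicate: "length (concat (replicate k xs)) = k * length xs"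
  by (induction k) simp_all

lemma set_concat_replicate_subset: "set (concat (replicate k xs)) \<subseteq> set xs"
  by (induction k) auto

lemma average_concat_replicate:
  "k > 0 \<Longrightarrow> average (concat (replicate k xs)) = average xs"
  by (simp add: average_def sum_list_concat_replicate length_concat_replicate)

definition averages :: "'x::real_vector set \<Rightarrow> 'x set" where
  "averages S = {average xs | xs. xs \<noteq> [] \<and> set xs \<subseteq> S}"

text \<open>Repeating the two lists in the right proportion turns a rational convex combination of two averages
into a single average.\<close>
lemma averages_rational_combination:
  assumes a: "a \<in> averages S" and b: "b \<in> averages S" and pq: "p \<le> q" "q > 0"
  shows "(1 - real p / real q) *\<^sub>R a + (real p / real q) *\<^sub>R b \<in> averages S"
proof -
  obtain xs ys where xs: "a = average xs" "xs \<noteq> []" "set xs \<subseteq> S"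
    and ys: "b = average ys" "ys \<noteq> []" "set ys \<subseteq> S"
    using a b by (auto simp: averages_def)
  define zs where "zs = concat (replicate ((q - p) * length ys) xs) @ concat (replicate (p * length xs) ys)"
  have len: "length zs = q * (length xs * length ys)"
  proof -
    have "length zs = ((q - p) + p) * (length xs * length ys)"
      unfolding zs_def length_append length_concat_replicate by (simp add: algebra_simps)
    then show ?thesis using pq by simp
  qed
  have "zs \<noteq> []" using len pq xs(2) ys(2) by auto
  moreover have "set zs \<subseteq> S"
    unfolding zs_def set_append
    by (intro Un_least order_trans[OF set_concat_replicate_subset] xs ys)
  moreover have "(1 - real p / real q) *\<^sub>R a + (real p / real q) *\<^sub>R b = average zs"
  proof -
    have "sum_list zs = (real (q - p) * real (length ys)) *\<^sub>R sum_list xs + (real p * real (length xs)) *\<^sub>R sum_list ys"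
      by (simp add: zs_def sum_list_concat_replicate)
    moreover have "real (q - p) = real q - real p" using pq by simp
    moreover have "real (length xs) \<noteq> 0" "real (length ys) \<noteq> 0" "real q \<noteq> 0"
      using pq xs(2) ys(2) by auto
    ultimately show ?thesis
      by (simp add: average_def xs ys len scaleR_add_right divide_simps del: of_nat_0_less_iff of_nat_eq_0_iff)
  qed
  ultimately show ?thesis unfolding averages_def by blast
qed

lemma convex_closure_averages:
  fixes S :: "'x::real_normed_vector set"
  shows "convex (closure (averages S))"
proof (rule convexI)
  fix x y :: 'x and u v :: real
  assume x: "x \<in> closure (averages S)" and y: "y \<in> closure (averages S)" and uv: "0 \<le> u" "0 \<le> v" "u + v = 1"
  obtain X Y where X: "\<And>n. X n \<in> averages S" "X \<longlonglongrightarrow> x" and Y: "\<And>n. Y n \<in> averages S" "Y \<longlonglongrightarrow> y"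
    using x y unfolding closure_sequential by blast
  \<comment> \<open>The rational numbers $p_n/(n+1)$ converge to the weight \<open>v\<close>.\<close>
  define p where "p n = nat \<lfloor>v * real (Suc n)\<rfloor>" for n
  define r where "r n = real (p n) / real (Suc n)" for n
  have p: "real (p n) \<le> v * real (Suc n)" "v * real (Suc n) - 1 \<le> real (p n)" for n
    unfolding p_def using uv by (auto simp: of_nat_nat intro: of_int_floor_le)
  have pn: "p n \<le> Suc n" for n
  proof -
    have "v * real (Suc n) \<le> 1 * real (Suc n)" using uv by (intro mult_right_mono) auto
    then have "real (p n) \<le> 1 * real (Suc n)" by (rule order_trans[OF p(1)])
    then show ?thesis by simp
  qed
  have "r \<longlonglongrightarrow> v"
  proof (rule tendsto_sandwich)
    show "\<forall>\<^sub>F n in sequentially. v - inverse (real (Suc n)) \<le> r n"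
    proof (intro always_eventually allI)
      fix n
      have "v - inverse (real (Suc n)) = (v * real (Suc n) - 1) / real (Suc n)"
        by (simp add: field_simps)
      also have "\<dots> \<le> r n" unfolding r_def by (rule divide_right_mono[OF p(2)]) simp
      finally show "v - inverse (real (Suc n)) \<le> r n" .
    qed
    show "\<forall>\<^sub>F n in sequentially. r n \<le> v"
      using p(1) by (intro always_eventually allI) (simp add: r_def field_simps)
    show "(\<lambda>n. v - inverse (real (Suc n))) \<longlonglongrightarrow> v"
      using tendsto_diff[OF tendsto_const LIMSEQ_inverse_real_of_nat, of v] by simp
  qed simp
  then have "(\<lambda>n. (1 - r n) *\<^sub>R X n + r n *\<^sub>R Y n) \<longlonglongrightarrow> (1 - v) *\<^sub>R x + v *\<^sub>R y"
    by (intro tendsto_intros X Y)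
  moreover have "(1 - r n) *\<^sub>R X n + r n *\<^sub>R Y n \<in> averages S" for n
    unfolding r_def by (rule averages_rational_combination[OF X(1) Y(1) pn]) simp
  moreover have "1 - v = u" using uv by simp
  ultimately show "u *\<^sub>R x + v *\<^sub>R y \<in> closure (averages S)"
    unfolding closure_sequential
    by (intro exI[of _ "\<lambda>n. (1 - r n) *\<^sub>R X n + r n *\<^sub>R Y n"]) simp
qed

text \<open>Lets arbitrary convex weights be replaced by equal ones, at the price of an arbitrarily small error.\<close>
lemma convex_hull_subset_closure_averages:
  fixes S :: "'x::real_normed_vector set"
  shows "convex hull S \<subseteq> closure (averages S)"
proof (rule hull_minimal)
  have "x \<in> averages S" if "x \<in> S" for x
    using that by (auto simp: averages_def average_def intro!: exI[of _ "[x]"])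
  then show "S \<subseteq> closure (averages S)" using closure_subset by blast
  show "convex (closure (averages S))" by (rule convex_closure_averages)
qed

text \<open>Repetition of a list does not change its average, so finitely many approximations can be brought to
the same length, the product of their lengths.\<close>
lemma finite_common_length_averages:
  fixes f :: "nat \<Rightarrow> 'x::real_normed_vector"
  assumes "\<And>j. j < q \<Longrightarrow> f j \<in> convex hull S j" and e: "e > 0"
  obtains N xs where "N > 0"
    "\<And>j. j < q \<Longrightarrow> length (xs j) = N \<and> set (xs j) \<subseteq> S j \<and> norm (f j - average (xs j)) < e"
proof -
  have "\<exists>ys. ys \<noteq> [] \<and> set ys \<subseteq> S j \<and> norm (f j - average ys) < e" if "j < q" for j
  proof -
    have "f j \<in> closure (averages (S j))"
      using assms(1)[OF that] convex_hull_subset_closure_averages by blast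
    then obtain a where "a \<in> averages (S j)" "dist a (f j) < e"
      using e closure_approachable by blast
    then show ?thesis by (auto simp: averages_def dist_norm norm_minus_commute)
  qed
  then obtain ys where ys: "\<And>j. j < q \<Longrightarrow> ys j \<noteq> [] \<and> set (ys j) \<subseteq> S j \<and> norm (f j - average (ys j)) < e"
    by metis
  define N where "N = (\<Prod>j<q. length (ys j))"
  have N: "N > 0" unfolding N_def using ys by (auto intro!: prod_pos)
  define xs where "xs j = concat (replicate (N div length (ys j)) (ys j))" for j
  show thesis
  proof (rule that[OF N])
    fix j assume j: "j < q"
    have "length (ys j) dvd N" unfolding N_def using j by (intro dvd_prodI) auto
    then have "N div length (ys j) * length (ys j) = N" by simp
    moreover from this N have "N div length (ys j) > 0" by (metis mult_is_0 neq0_conv)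
    ultimately show "length (xs j) = N \<and> set (xs j) \<subseteq> S j \<and> norm (f j - average (xs j)) < e"
      using ys[OF j] set_concat_replicate_subset[of "N div length (ys j)" "ys j"]
      by (auto simp: xs_def length_concat_replicate average_concat_replicate)
  qed
qed

section \<open>Bushes and the Radon-Nikodym property\<close>

text \<open>In a tree in which every node of one level has \<open>n\<close> children, the children of node \<open>j\<close> are numbered
\<open>j * n + i\<close> with \<open>i < n\<close>.\<close>
lemma sum_children:
  "(\<Sum>k<q * n. g k) = (\<Sum>j<q. \<Sum>i<n. g (j * n + i :: nat) :: 'b::comm_monoid_add)"
proof -
  have "(\<Sum>i<n. g (j * n + i)) = sum g {j * n..<j * n + n}" for j
    using sum.shift_bounds_nat_ivl[of g 0 "j * n" n] by (simp add: atLeast0LessThan add.commute)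
  then show ?thesis by (simp add: sum.nat_group)
qed

lemma child_index:
  assumes "k < q * n"
  obtains j i where "j < q" "i < n" "k = j * n + (i::nat)"
proof
  have "n > 0" using assms by (cases n) auto
  then show "k mod n < n" by simp
  show "k div n < q" using assms by (simp add: less_mult_imp_div_less)
  show "k = k div n * n + k mod n" by simp
qed

lemma child_index_less: "j < q \<Longrightarrow> i < n \<Longrightarrow> j * n + i < q * (n::nat)"
  by (metis add.commute add_less_cancel_left less_le_trans mult.commute mult_Suc_right mult_le_mono2 Suc_leI)

text \<open>A probability space whose \<open>\<sigma>\<close>-algebra is generated by successive partitions into cells of equal
probability: level \<open>n\<close> has the \<open>Q n\<close> cells \<open>c n j\<close>, each of which splits into \<open>N n\<close> cells of the next
level. The empty set is added to the generator to make it stable under intersection.\<close>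
locale cell_filtration = prob_space M for M :: "'w measure" +
  fixes N Q :: "nat \<Rightarrow> nat" and c :: "nat \<Rightarrow> nat \<Rightarrow> 'w set"
  assumes N_pos: "N n > 0"
    and Q_0: "Q 0 = 1" and Q_Suc: "Q (Suc n) = Q n * N n"
    and sets_eq: "sets M = sigma_sets (space M) (insert {} {c n j | n j. j < Q n})"
    and prob_cell: "j < Q n \<Longrightarrow> prob (c n j) = 1 / real (Q n)"
    and cell_0: "c 0 0 = space M"
    and cell_Suc: "c n j = (\<Union>i<N n. c (Suc n) (j * N n + i))"
    and cells_disjoint: "i < Q n \<Longrightarrow> j < Q n \<Longrightarrow> i \<noteq> j \<Longrightarrow> c n i \<inter> c n j = {}"
begin

lemma Q_pos: "Q n > 0"
  by (induction n) (auto simp: Q_0 Q_Suc N_pos)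

lemma child_cell_subset: "i < N n \<Longrightarrow> c (Suc n) (j * N n + i) \<subseteq> c n j"
  using cell_Suc[of n j] by auto

lemma UN_cells: "(\<Union>j<Q n. c n j) = space M"
proof (induction n)
  case (Suc n)
  have "(\<Union>k<Q (Suc n). c (Suc n) k) = (\<Union>j<Q n. c n j)"
  proof (intro equalityI UN_least)
    fix k assume "k \<in> {..<Q (Suc n)}"
    then obtain j i where "j < Q n" "i < N n" "k = j * N n + i"
      by (auto simp: Q_Suc elim: child_index)
    then show "c (Suc n) k \<subseteq> (\<Union>j<Q n. c n j)" using child_cell_subset by blast
  next
    fix j assume "j \<in> {..<Q n}"
    then show "c n j \<subseteq> (\<Union>k<Q (Suc n). c (Suc n) k)"
      unfolding cell_Suc[of n j] using child_index_less[of j "Q n" _ "N n"]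
      by (auto simp: Q_Suc)
  qed
  then show ?case using Suc by simp
qed (simp add: Q_0 cell_0 lessThan_Suc)

lemma cell_sets [measurable]: "j < Q n \<Longrightarrow> c n j \<in> sets M"
  unfolding sets_eq by (rule sigma_sets.Basic) auto

lemma cells_nested:
  assumes "n \<le> m" "j < Q n" "k < Q m"
  shows "c m k \<subseteq> c n j \<or> c n j \<inter> c m k = {}"
  using assms(1,3)
proof (induction m arbitrary: k rule: dec_induct)
  case base
  then show ?case using cells_disjoint[OF assms(2), of k] by (cases "k = j") auto
next
  case (step m)
  obtain k' i where "k' < Q m" "i < N m" "k = k' * N m + i"
    using step.prems by (auto simp: Q_Suc elim: child_index)
  then show ?case using step.IH[of k'] child_cell_subset[of i m k'] by blast
qed

lemma prob_Int_child:
  assumes "n \<le> m" "j < Q n" "k < Q m" "i < N m"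
  shows "prob (c n j \<inter> c (Suc m) (k * N m + i)) = prob (c n j \<inter> c m k) / N m"
proof -
  have child: "k * N m + i < Q (Suc m)" using child_index_less[OF assms(3,4)] by (simp add: Q_Suc)
  note sub = child_cell_subset[OF assms(4), of k]
  from cells_nested[OF assms(1-3)] show ?thesis
  proof
    assume "c m k \<subseteq> c n j"
    then have "c n j \<inter> c (Suc m) (k * N m + i) = c (Suc m) (k * N m + i)" "c n j \<inter> c m k = c m k"
      using sub by auto
    then show ?thesis using prob_cell[OF child] prob_cell[OF assms(3)] by (simp add: Q_Suc)
  next
    assume "c n j \<inter> c m k = {}"
    moreover from this have "c n j \<inter> c (Suc m) (k * N m + i) = {}" using sub by auto
    ultimately show ?thesis by simp
  qed
qed

lemma finite_measure_sum_cells: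
  assumes \<mu>: "finite_measure \<mu>" "sets \<mu> = sets M" and E: "E \<in> sets M"
  shows "(\<Sum>j<Q n. measure \<mu> (E \<inter> c n j)) = measure \<mu> E"
proof -
  interpret \<mu>: finite_measure \<mu> by fact
  have "measure \<mu> (\<Union>j<Q n. E \<inter> c n j) = (\<Sum>j<Q n. measure \<mu> (E \<inter> c n j))"
    using E cells_disjoint[of _ n]
    by (intro \<mu>.finite_measure_finite_Union) (auto simp: \<mu>(2) disjoint_family_on_def)
  moreover have "(\<Union>j<Q n. E \<inter> c n j) = E"
    using UN_cells[of n] sets.sets_into_space[OF E] by blast
  ultimately show ?thesis by simp
qed

lemmas prob_sum_cells = finite_measure_sum_cells[OF finite_measure_axioms refl]

lemma prob_tail_tendsto_0:
  assumes A: "range A \<subseteq> sets M"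
  shows "(\<lambda>k::nat. prob ((\<Union>i. A i) - (\<Union>i<k. A i))) \<longlonglongrightarrow> 0"
proof -
  have "(\<lambda>k. prob (\<Union>i<k. A i)) \<longlonglongrightarrow> prob (\<Union>k. \<Union>i<k. A i)"
    using A by (intro finite_Lim_measure_incseq) (auto simp: incseq_def intro: order.strict_trans2)
  moreover have "(\<Union>k. \<Union>i<k. A i) = (\<Union>i. A i)" by auto
  ultimately have "(\<lambda>k. prob (\<Union>i<k. A i)) \<longlonglongrightarrow> prob (\<Union>i. A i)" by simp
  from tendsto_diff[OF tendsto_const[of "prob (\<Union>i. A i)"] this]
  have "(\<lambda>k. prob (\<Union>i. A i) - prob (\<Union>i<k. A i)) \<longlonglongrightarrow> 0" by simp
  moreover have "prob ((\<Union>i. A i) - (\<Union>i<k. A i)) = prob (\<Union>i. A i) - prob (\<Union>i<k. A i)" for k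
    using A by (intro finite_measure_Diff) auto
  ultimately show ?thesis by simp
qed

text \<open>Dynkin's \<open>\<pi>\<close>-\<open>\<lambda>\<close> theorem for the cells. Closure under countable disjoint unions is replaced by finite
ones together with approximation from inside in probability, the form in which the properties
below are checked.\<close>
lemma event_induct [consumes 1, case_names cell compl disjoint approx]:
  assumes E: "E \<in> sets M"
    and cell: "\<And>n j. j < Q n \<Longrightarrow> P (c n j)"
    and compl: "\<And>E. E \<in> sets M \<Longrightarrow> P E \<Longrightarrow> P (space M - E)"
    and disjoint: "\<And>E F. E \<in> sets M \<Longrightarrow> F \<in> sets M \<Longrightarrow> E \<inter> F = {} \<Longrightarrow> P E \<Longrightarrow> P F \<Longrightarrow> P (E \<union> F)"
    and approx: "\<And>E. E \<in> sets M \<Longrightarrow> (\<And>\<epsilon>. \<epsilon> > 0 \<Longrightarrow> \<exists>F\<in>sets M. F \<subseteq> E \<and> P F \<and> prob (E - F) < \<epsilon>) \<Longrightarrow> P E"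
  shows "P E"
proof -
  have P_empty: "P {}"
    using compl[OF sets.top] cell[of 0 0] by (simp add: Q_0 cell_0)
  let ?G = "insert {} {c n j | n j. j < Q n}"
  have stable: "Int_stable ?G"
  proof (rule Int_stableI)
    fix a b assume ab: "a \<in> ?G" "b \<in> ?G"
    have "c n i \<inter> c m j \<in> {{}, c n i, c m j}" if "i < Q n" "j < Q m" for n m i j
      using cells_nested[of n m i j] cells_nested[of m n j i] that
      by (cases "n \<le> m") auto
    note cells = this
    have "a \<inter> b \<in> {{}, a, b}"
    proof (cases "a = {} \<or> b = {}")
      case False
      then obtain n i m j where "i < Q n" "a = c n i" "j < Q m" "b = c m j" using ab by blast
      then show ?thesis using cells[of i n j m] by simp
    qed auto
    then show "a \<inter> b \<in> ?G" using ab by auto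
  qed
  have space: "?G \<subseteq> Pow (space M)"
    using sets.sets_into_space cell_sets by blast
  show ?thesis
    using stable space E[unfolded sets_eq]
  proof (induction rule: sigma_sets_induct_disjoint)
    case (union A)
    then have A: "range A \<subseteq> sets M" by (simp add: sets_eq)
    have fin: "P (\<Union>i<k. A i)" for k
    proof (induction k)
      case (Suc k)
      have "A i \<inter> A k = {}" if "i < k" for i
        using disjoint_family_onD[OF \<open>disjoint_family A\<close>, of i k] that by simp
      then have "(\<Union>i<k. A i) \<inter> A k = {}" by blast
      then have "P ((\<Union>i<k. A i) \<union> A k)"
        using A Suc union by (intro disjoint) auto
      then show ?case by (simp add: lessThan_Suc Un_commute)
    qed (simp add: P_empty)
    show ?case
    proof (rule approx)
      fix \<epsilon> :: real assume "\<epsilon> > 0"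
      then obtain k where "prob ((\<Union>i. A i) - (\<Union>i<k. A i)) < \<epsilon>"
        using order_tendstoD(2)[OF prob_tail_tendsto_0[OF A]] eventually_happens by fastforce
      then show "\<exists>F\<in>sets M. F \<subseteq> (\<Union>i. A i) \<and> P F \<and> prob ((\<Union>i. A i) - F) < \<epsilon>"
        using A fin by (intro bexI[of _ "\<Union>i<k. A i"]) auto
    qed (use A in auto)
  qed (auto simp: P_empty sets_eq intro: cell compl)
qed

text \<open>The distance in $L^1$ between the conditional expectations of the indicator of \<open>E\<close> on levels \<open>n\<close> and
\<open>n + 1\<close>. It tends to \<open>0\<close> for every event, which is all that is needed here of the martingale
convergence theorem.\<close>
definition defect :: "nat \<Rightarrow> 'w set \<Rightarrow> real" where
  "defect n E = (\<Sum>j<Q n. \<Sum>i<N n. \<bar>prob (E \<inter> c (Suc n) (j * N n + i)) - prob (E \<inter> c n j) / N n\<bar>)"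

lemma defect_nonneg: "0 \<le> defect n E"
  unfolding defect_def by (intro sum_nonneg) simp

lemma defect_cell: "n \<le> m \<Longrightarrow> j < Q n \<Longrightarrow> defect m (c n j) = 0"
  by (simp add: defect_def prob_Int_child)

lemma prob_Int_Un_disjoint:
  assumes "E \<in> sets M" "F \<in> sets M" "E \<inter> F = {}" "A \<in> sets M"
  shows "prob ((E \<union> F) \<inter> A) = prob (E \<inter> A) + prob (F \<inter> A)"
  using finite_measure_Union[of "E \<inter> A" "F \<inter> A"] assms by (auto simp: Int_Un_distrib2)

lemma child_sets: "j < Q n \<Longrightarrow> i < N n \<Longrightarrow> c (Suc n) (j * N n + i) \<in> sets M"
  using child_index_less[of j "Q n" i "N n"] by (simp add: Q_Suc)

lemma sum_prob_children:
  "E \<in> sets M \<Longrightarrow> (\<Sum>j<Q n. \<Sum>i<N n. prob (E \<inter> c (Suc n) (j * N n + i))) = prob E"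
  using prob_sum_cells[of E "Suc n"] by (simp add: Q_Suc sum_children)

lemma defect_le:
  assumes "E \<in> sets M"
  shows "defect n E \<le> 2 * prob E"
proof -
  have "defect n E \<le> (\<Sum>j<Q n. \<Sum>i<N n. prob (E \<inter> c (Suc n) (j * N n + i)) + prob (E \<inter> c n j) / N n)"
    unfolding defect_def
    by (intro sum_mono order_trans[OF abs_triangle_ineq4]) (simp add: abs_divide)
  also have "\<dots> = prob E + prob E"
    using N_pos[of n] by (simp add: sum.distrib sum_prob_children assms prob_sum_cells)
  finally show ?thesis by simp
qed

lemma defect_Un:
  assumes "E \<in> sets M" "F \<in> sets M" "E \<inter> F = {}"
  shows "defect n (E \<union> F) \<le> defect n E + defect n F"
  unfolding defect_def sum.distrib[symmetric]
  by (intro sum_mono) (auto simp: prob_Int_Un_disjoint assms child_sets add_divide_distrib)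

lemma defect_compl:
  assumes E: "E \<in> sets M"
  shows "defect n (space M - E) = defect n E"
proof -
  have compl: "prob ((space M - E) \<inter> A) = prob A - prob (E \<inter> A)" if "A \<in> sets M" for A
    using finite_measure_Diff[of A "E \<inter> A"] that E sets.sets_into_space[OF that]
    by (simp add: Diff_Int_distrib2 Int_absorb1 Diff_Int2 Diff_Int)
  show ?thesis
    unfolding defect_def
  proof (intro sum.cong refl)
    fix j i assume "j \<in> {..<Q n}" "i \<in> {..<N n}"
    then have ji: "j < Q n" "i < N n" by auto
    have k: "j * N n + i < Q (Suc n)" using child_index_less[OF ji] by (simp add: Q_Suc)
    show "\<bar>prob ((space M - E) \<inter> c (Suc n) (j * N n + i)) - prob ((space M - E) \<inter> c n j) / N n\<bar>
      = \<bar>prob (E \<inter> c (Suc n) (j * N n + i)) - prob (E \<inter> c n j) / N n\<bar>"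
      using ji k by (simp add: compl prob_cell Q_Suc diff_divide_distrib)
  qed
qed

lemma defect_tendsto_0: "E \<in> sets M \<Longrightarrow> (\<lambda>n. defect n E) \<longlonglongrightarrow> 0"
proof (induction rule: event_induct)
  case (cell n j)
  then have "\<forall>\<^sub>F m in sequentially. defect m (c n j) = 0"
    using defect_cell by (intro eventually_sequentiallyI[of n]) simp
  then show ?case by (rule tendsto_eventually)
next
  case (compl E)
  then show ?case by (simp add: defect_compl)
next
  case (disjoint E F)
  show ?case
    by (rule tendsto_sandwich[OF _ _ tendsto_const tendsto_add_zero[OF disjoint(4,5)]])
      (auto simp: defect_nonneg defect_Un disjoint)
next
  case (approx E)
  show ?case
  proof (rule LIMSEQ_I)
    fix r :: real assume r: "r > 0"
    then obtain F where F: "F \<in> sets M" "F \<subseteq> E" "(\<lambda>n. defect n F) \<longlonglongrightarrow> 0" "prob (E - F) < r / 4"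
      using approx(2)[of "r / 4"] by auto
    obtain n0 where n0: "\<And>n. n \<ge> n0 \<Longrightarrow> defect n F < r / 2"
      using order_tendstoD(2)[OF F(3), of "r / 2"] r by (auto simp: eventually_sequentially)
    have "norm (defect n E - 0) < r" if "n \<ge> n0" for n
    proof -
      have "F \<union> (E - F) = E" using F(2) by auto
      then have "defect n E \<le> defect n F + defect n (E - F)"
        using defect_Un[of F "E - F" n] F(1) approx(1) by auto
      also have "\<dots> \<le> defect n F + 2 * prob (E - F)"
        using defect_le[of "E - F" n] F(1) approx(1) by auto
      finally show ?thesis using n0[OF that] F(4) defect_nonneg[of n E] by simp
    qed
    then show "\<exists>n0. \<forall>n\<ge>n0. norm (defect n E - 0) < r" by blast
  qed
qed

end

lemma convergent_approx:
  fixes X :: "nat \<Rightarrow> 'x::banach"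
  assumes "\<And>\<epsilon>. \<epsilon> > 0 \<Longrightarrow> \<exists>Y. convergent Y \<and> (\<forall>n. norm (X n - Y n) < \<epsilon>)"
  shows "convergent X"
  unfolding Cauchy_convergent_iff[symmetric]
proof (rule metric_CauchyI)
  fix e :: real assume "e > 0"
  then obtain Y where Y: "Cauchy Y" "\<And>n. norm (X n - Y n) < e / 3"
    using assms[of "e / 3"] by (auto simp: Cauchy_convergent_iff)
  obtain m0 where m0: "\<And>m n. m \<ge> m0 \<Longrightarrow> n \<ge> m0 \<Longrightarrow> dist (Y m) (Y n) < e / 3"
    using metric_CauchyD[OF Y(1), of "e / 3"] \<open>e > 0\<close> by auto
  have "dist (X m) (X n) < e" if "m \<ge> m0" "n \<ge> m0" for m n
  proof -
    have "dist (X m) (X n) \<le> dist (X m) (Y m) + dist (Y m) (Y n) + dist (X n) (Y n)"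
      by (metis dist_commute dist_triangle2 dist_triangle_le add.assoc add_left_mono order_trans dist_triangle)
    then show ?thesis using Y(2)[of m] Y(2)[of n] m0[OF that] by (simp add: dist_norm)
  qed
  then show "\<exists>m0. \<forall>m\<ge>m0. \<forall>n\<ge>m0. dist (X m) (X n) < e" by blast
qed

lemma two_power_add:
  "(2::real) ^ (m + 2) = 4 * 2 ^ m" "(2::real) ^ (m + 3) = 8 * 2 ^ m" "(2::real) ^ (Suc m + 2) = 8 * 2 ^ m"
  by (simp_all add: power_add)

text \<open>A bounded function on the cells that is almost a martingale, with summable errors, although each
of its steps has length at least \<open>\<eta>\<close>. Its values form a bush in the sense of the geometry of Banach
spaces.\<close>
locale cell_bush = cell_filtration M N Q c for M :: "'w measure" and N Q c +
  fixes v :: "nat \<Rightarrow> nat \<Rightarrow> 'x::banach" and \<eta> :: real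
  assumes \<eta>_pos: "\<eta> > 0"
    and norm_v: "j < Q n \<Longrightarrow> norm (v n j) \<le> 1"
    and v_average: "j < Q n \<Longrightarrow>
      norm (v n j - (1 / real (N n)) *\<^sub>R (\<Sum>i<N n. v (Suc n) (j * N n + i))) \<le> \<eta> / 2 ^ (n + 3)"
    and v_apart: "j < Q n \<Longrightarrow> i < N n \<Longrightarrow> \<eta> \<le> norm (v (Suc n) (j * N n + i) - v n j)"
begin

text \<open>The integral over \<open>E\<close> of the step function with value \<open>v n j\<close> on the cell \<open>c n j\<close>.\<close>
definition step_integral :: "nat \<Rightarrow> 'w set \<Rightarrow> 'x" where
  "step_integral n E = (\<Sum>j<Q n. prob (E \<inter> c n j) *\<^sub>R v n j)"

lemma norm_step_integral_le:
  assumes "E \<in> sets M"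
  shows "norm (step_integral n E) \<le> prob E"
proof -
  have "norm (step_integral n E) \<le> (\<Sum>j<Q n. prob (E \<inter> c n j) * 1)"
    unfolding step_integral_def by (intro sum_norm_le) (simp add: mult_left_le norm_v)
  then show ?thesis by (simp add: prob_sum_cells assms)
qed

lemma step_integral_Un:
  assumes "E \<in> sets M" "F \<in> sets M" "E \<inter> F = {}"
  shows "step_integral n (E \<union> F) = step_integral n E + step_integral n F"
  by (simp add: step_integral_def prob_Int_Un_disjoint assms scaleR_left_distrib sum.distrib)

lemma step_integral_cell_step:
  assumes "n \<le> m" "j < Q n"
  shows "norm (step_integral (Suc m) (c n j) - step_integral m (c n j)) \<le> \<eta> / 2 ^ (m + 3) * prob (c n j)"
proof -
  have "step_integral (Suc m) (c n j) = (\<Sum>k<Q m. prob (c n j \<inter> c m k) *\<^sub>R ((1 / real (N m)) *\<^sub>R (\<Sum>i<N m. v (Suc m) (k * N m + i))))"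
    by (simp add: step_integral_def Q_Suc sum_children prob_Int_child[OF assms] scaleR_sum_right)
  then have step: "step_integral (Suc m) (c n j) - step_integral m (c n j) =
      (\<Sum>k<Q m. prob (c n j \<inter> c m k) *\<^sub>R ((1 / real (N m)) *\<^sub>R (\<Sum>i<N m. v (Suc m) (k * N m + i)) - v m k))"
    by (simp add: step_integral_def sum_subtractf scaleR_diff_right)
  have "norm (step_integral (Suc m) (c n j) - step_integral m (c n j)) \<le> (\<Sum>k<Q m. prob (c n j \<inter> c m k) * (\<eta> / 2 ^ (m + 3)))"
    unfolding step
  proof (rule sum_norm_le)
    fix k assume "k \<in> {..<Q m}"
    then have "norm ((1 / real (N m)) *\<^sub>R (\<Sum>i<N m. v (Suc m) (k * N m + i)) - v m k) \<le> \<eta> / 2 ^ (m + 3)"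
      using v_average[of k m] by (simp add: norm_minus_commute)
    from mult_left_mono[OF this measure_nonneg]
    show "norm (prob (c n j \<inter> c m k) *\<^sub>R ((1 / real (N m)) *\<^sub>R (\<Sum>i<N m. v (Suc m) (k * N m + i)) - v m k))
        \<le> prob (c n j \<inter> c m k) * (\<eta> / 2 ^ (m + 3))"
      by simp
  qed
  moreover have "(\<Sum>k<Q m. prob (c n j \<inter> c m k) * (\<eta> / 2 ^ (m + 3))) = prob (c n j) * (\<eta> / 2 ^ (m + 3))"
    using prob_sum_cells[OF cell_sets[OF assms(2)], of m]
    by (simp add: sum_distrib_right[symmetric] sum_divide_distrib[symmetric])
  ultimately show ?thesis by (simp add: mult.commute)
qed

lemma step_integral_cell_same:
  assumes "j < Q n"
  shows "step_integral n (c n j) = prob (c n j) *\<^sub>R v n j"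
proof -
  have "step_integral n (c n j) = (\<Sum>k<Q n. if k = j then prob (c n j) *\<^sub>R v n j else 0)"
    unfolding step_integral_def
  proof (intro sum.cong refl)
    fix k assume "k \<in> {..<Q n}"
    then show "prob (c n j \<inter> c n k) *\<^sub>R v n k = (if k = j then prob (c n j) *\<^sub>R v n j else 0)"
      using cells_disjoint[OF assms, of k] by auto
  qed
  then show ?thesis using assms by simp
qed

text \<open>The errors of the levels \<open>n\<close> to \<open>m - 1\<close> add up to this telescoping difference.\<close>
lemma step_integral_cell_close:
  assumes "n \<le> m" "j < Q n"
  shows "norm (step_integral m (c n j) - prob (c n j) *\<^sub>R v n j) \<le> (\<eta> / 2 ^ (n + 2) - \<eta> / 2 ^ (m + 2)) * prob (c n j)"
  using assms(1)
proof (induction m rule: dec_induct)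
  case base
  then show ?case by (simp add: step_integral_cell_same assms(2))
next
  case (step m)
  have "norm (step_integral (Suc m) (c n j) - prob (c n j) *\<^sub>R v n j) \<le>
      norm (step_integral (Suc m) (c n j) - step_integral m (c n j)) + norm (step_integral m (c n j) - prob (c n j) *\<^sub>R v n j)"
    by (rule norm_diff_triangle_le[OF order_refl order_refl])
  also have "\<dots> \<le> \<eta> / 2 ^ (m + 3) * prob (c n j) + (\<eta> / 2 ^ (n + 2) - \<eta> / 2 ^ (m + 2)) * prob (c n j)"
    by (intro add_mono step_integral_cell_step step assms)
  also have "\<dots> = (\<eta> / 2 ^ (n + 2) - \<eta> / 2 ^ (Suc m + 2)) * prob (c n j)"
    unfolding two_power_add by (simp add: field_simps)
  finally show ?case .
qed

lemma convergent_step_integral_cell: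
  assumes "j < Q n"
  shows "convergent (\<lambda>m. step_integral m (c n j))"
proof -
  have "summable (\<lambda>m. step_integral (Suc m) (c n j) - step_integral m (c n j))"
  proof (rule summable_comparison_test')
    show "summable (\<lambda>m. \<eta> / 8 * prob (c n j) * (1 / 2) ^ m)"
      by (intro summable_mult summable_geometric) simp
    fix m assume "m \<ge> n"
    then have "norm (step_integral (Suc m) (c n j) - step_integral m (c n j)) \<le> \<eta> / 2 ^ (m + 3) * prob (c n j)"
      by (rule step_integral_cell_step[OF _ assms])
    also have "\<dots> = \<eta> / 8 * prob (c n j) * (1 / 2) ^ m"
      unfolding two_power_add by (simp add: power_one_over)
    finally show "norm (step_integral (Suc m) (c n j) - step_integral m (c n j)) \<le> \<eta> / 8 * prob (c n j) * (1 / 2) ^ m" .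
  qed
  then have "convergent (\<lambda>k. \<Sum>m<k. step_integral (Suc m) (c n j) - step_integral m (c n j))"
    by (simp add: summable_iff_convergent)
  moreover have "(\<Sum>m<k. step_integral (Suc m) (c n j) - step_integral m (c n j)) = step_integral k (c n j) - step_integral 0 (c n j)" for k
    by (rule sum_lessThan_telescope)
  ultimately have "convergent (\<lambda>k. step_integral k (c n j) - step_integral 0 (c n j))" by simp
  then show ?thesis by (simp add: convergent_diff_const_right_iff)
qed

text \<open>On a cell the integrals form a Cauchy sequence since the errors are summable; the bound of
\<open>norm_step_integral_le\<close> carries convergence over to all events.\<close>
lemma convergent_step_integral: "E \<in> sets M \<Longrightarrow> convergent (\<lambda>n. step_integral n E)"
proof (induction rule: event_induct)
  case (cell n j)
  then show ?case by (rule convergent_step_integral_cell)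
next
  case (compl E)
  have "step_integral n E + step_integral n (space M - E) = step_integral n (space M)" for n
    using step_integral_Un[of E "space M - E" n] compl(1) sets.sets_into_space[OF compl(1)]
    by (simp add: Un_absorb1)
  then have "(\<lambda>n. step_integral n (space M - E)) = (\<lambda>n. step_integral n (space M) - step_integral n E)"
    by (auto simp: algebra_simps)
  moreover have "convergent (\<lambda>n. step_integral n (space M))"
    using convergent_step_integral_cell[of 0 0] by (simp add: Q_0 cell_0)
  ultimately show ?case using compl(2) by (simp add: convergent_diff)
next
  case (disjoint E F)
  then show ?case by (simp add: step_integral_Un convergent_add)
next
  case (approx E)
  show ?case
  proof (rule convergent_approx)
    fix \<epsilon> :: real assume "\<epsilon> > 0"
    then obtain F where F: "F \<in> sets M" "F \<subseteq> E" "convergent (\<lambda>n. step_integral n F)" "prob (E - F) < \<epsilon>"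
      using approx(2) by blast
    have "norm (step_integral n E - step_integral n F) < \<epsilon>" for n
    proof -
      have "step_integral n E = step_integral n F + step_integral n (E - F)"
        using step_integral_Un[of F "E - F" n] F approx(1) by (simp add: Un_absorb1)
      then have "norm (step_integral n E - step_integral n F) = norm (step_integral n (E - F))" by simp
      also have "\<dots> \<le> prob (E - F)" using norm_step_integral_le[of "E - F" n] F(1) approx(1) by simp
      finally show ?thesis using F(4) by simp
    qed
    then show "\<exists>Y. convergent Y \<and> (\<forall>n. norm (step_integral n E - Y n) < \<epsilon>)" using F(3) by blast
  qed
qed

definition bush_measure :: "'w set \<Rightarrow> 'x" where
  "bush_measure E = lim (\<lambda>n. step_integral n E)"

lemma step_integral_tendsto_bush_measure: "E \<in> sets M \<Longrightarrow> (\<lambda>n. step_integral n E) \<longlonglongrightarrow> bush_measure E"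
  unfolding bush_measure_def by (rule convergent_LIMSEQ_iff[THEN iffD1, OF convergent_step_integral])

lemma norm_bush_measure_le: "E \<in> sets M \<Longrightarrow> norm (bush_measure E) \<le> prob E"
  by (rule Lim_norm_ubound[OF _ step_integral_tendsto_bush_measure]) (auto simp: norm_step_integral_le)

lemma bush_measure_Un:
  assumes "E \<in> sets M" "F \<in> sets M" "E \<inter> F = {}"
  shows "bush_measure (E \<union> F) = bush_measure E + bush_measure F"
proof (rule LIMSEQ_unique)
  show "(\<lambda>n. step_integral n (E \<union> F)) \<longlonglongrightarrow> bush_measure (E \<union> F)" using assms by (intro step_integral_tendsto_bush_measure) auto
  show "(\<lambda>n. step_integral n (E \<union> F)) \<longlonglongrightarrow> bush_measure E + bush_measure F"
    unfolding step_integral_Un[OF assms] using assms by (intro tendsto_add step_integral_tendsto_bush_measure)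
qed

lemma bush_measure_cell_close:
  assumes "j < Q n"
  shows "norm (bush_measure (c n j) - prob (c n j) *\<^sub>R v n j) \<le> \<eta> / 2 ^ (n + 2) * prob (c n j)"
proof (rule Lim_norm_ubound)
  show "(\<lambda>m. step_integral m (c n j) - prob (c n j) *\<^sub>R v n j) \<longlonglongrightarrow> bush_measure (c n j) - prob (c n j) *\<^sub>R v n j"
    by (intro tendsto_intros step_integral_tendsto_bush_measure cell_sets assms)
  show "\<forall>\<^sub>F m in sequentially. norm (step_integral m (c n j) - prob (c n j) *\<^sub>R v n j) \<le> \<eta> / 2 ^ (n + 2) * prob (c n j)"
  proof (rule eventually_sequentiallyI)
    fix m assume "m \<ge> n"
    have "(\<eta> / 2 ^ (n + 2) - \<eta> / 2 ^ (m + 2)) * prob (c n j) \<le> \<eta> / 2 ^ (n + 2) * prob (c n j)"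
      using \<eta>_pos by (intro mult_right_mono) auto
    then show "norm (step_integral m (c n j) - prob (c n j) *\<^sub>R v n j) \<le> \<eta> / 2 ^ (n + 2) * prob (c n j)"
      using step_integral_cell_close[OF \<open>m \<ge> n\<close> assms] by linarith
  qed
qed simp

text \<open>The limit measure keeps the oscillation of the bush: its average over a child cell differs from that
over the parent cell by at least \<open>\<eta> / 2\<close>. The errors from level \<open>n\<close> and from level \<open>n + 1\<close> onwards take
away at most \<open>\<eta> / 4 + \<eta> / 8\<close>.\<close>
lemma bush_measure_child_deviation:
  assumes j: "j < Q n" and i: "i < N n"
  shows "\<eta> / 2 / Q (Suc n) \<le> norm (bush_measure (c (Suc n) (j * N n + i)) - (1 / real (N n)) *\<^sub>R bush_measure (c n j))"
proof -
  let ?k = "j * N n + i" let ?p = "1 / real (Q (Suc n))"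
  have k: "?k < Q (Suc n)" using child_index_less[OF j i] by (simp add: Q_Suc)
  have p: "?p > 0" using Q_pos[of "Suc n"] by simp
  have pow: "\<eta> / 2 ^ (Suc n + 2) \<le> \<eta> / 8" "\<eta> / 2 ^ (n + 2) \<le> \<eta> / 4"
    using \<eta>_pos divide_left_mono[OF one_le_power[of "2::real" n], of \<eta>] by (auto simp: power_add)
  have "norm (bush_measure (c (Suc n) ?k) - ?p *\<^sub>R v (Suc n) ?k) \<le> \<eta> / 2 ^ (Suc n + 2) * ?p"
    using bush_measure_cell_close[OF k] by (simp only: prob_cell[OF k])
  also have "\<dots> \<le> \<eta> / 8 * ?p" using pow p by (intro mult_right_mono) auto
  finally have child: "norm (bush_measure (c (Suc n) ?k) - ?p *\<^sub>R v (Suc n) ?k) \<le> \<eta> / 8 * ?p" .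
  have "(1 / real (N n)) *\<^sub>R bush_measure (c n j) - ?p *\<^sub>R v n j = (1 / real (N n)) *\<^sub>R (bush_measure (c n j) - prob (c n j) *\<^sub>R v n j)"
    using j by (simp add: prob_cell Q_Suc scaleR_diff_right mult.commute)
  then have "norm ((1 / real (N n)) *\<^sub>R bush_measure (c n j) - ?p *\<^sub>R v n j) = (1 / real (N n)) * norm (bush_measure (c n j) - prob (c n j) *\<^sub>R v n j)"
    by simp
  also have "\<dots> \<le> (1 / real (N n)) * (\<eta> / 4 * prob (c n j))"
    by (intro mult_left_mono order_trans[OF bush_measure_cell_close[OF j] mult_right_mono[OF pow(2) measure_nonneg]]) simp
  also have "\<dots> = \<eta> / 4 * ?p" using j by (simp add: prob_cell Q_Suc)
  finally have parent: "norm ((1 / real (N n)) *\<^sub>R bush_measure (c n j) - ?p *\<^sub>R v n j) \<le> \<eta> / 4 * ?p" .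
  let ?d = "bush_measure (c (Suc n) ?k) - (1 / real (N n)) *\<^sub>R bush_measure (c n j)"
  let ?a = "bush_measure (c (Suc n) ?k) - ?p *\<^sub>R v (Suc n) ?k"
  let ?b = "(1 / real (N n)) *\<^sub>R bush_measure (c n j) - ?p *\<^sub>R v n j"
  have "\<eta> * ?p \<le> norm (v (Suc n) ?k - v n j) * ?p"
    using p by (intro mult_right_mono v_apart[OF j i]) simp
  also have "\<dots> = norm (?p *\<^sub>R (v (Suc n) ?k - v n j))"
    using p by simp
  also have "?p *\<^sub>R (v (Suc n) ?k - v n j) = ?d - ?a + ?b"
    unfolding scaleR_diff_right by simp
  also have "norm (?d - ?a + ?b) \<le> norm ?d + norm ?a + norm ?b"
    using norm_triangle_ineq[of "?d - ?a" ?b] norm_triangle_ineq4[of ?d ?a] by linarith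
  also have "\<dots> \<le> norm ?d + \<eta> / 8 * ?p + \<eta> / 4 * ?p"
    using child parent by linarith
  finally have "\<eta> * ?p - \<eta> / 8 * ?p - \<eta> / 4 * ?p \<le> norm (bush_measure (c (Suc n) ?k) - (1 / real (N n)) *\<^sub>R bush_measure (c n j))"
    by simp
  moreover have "\<eta> / 2 * ?p \<le> \<eta> * ?p - \<eta> / 8 * ?p - \<eta> / 4 * ?p"
    using mult_pos_pos[OF \<eta>_pos p] by simp
  ultimately show ?thesis by simp
qed

lemma vector_measure_bush_measure: "vector_measure M bush_measure"
  unfolding vector_measure_def
proof (intro allI impI)
  fix A :: "nat \<Rightarrow> 'w set" assume A: "range A \<subseteq> sets M" "disjoint_family A"
  have fin: "(\<Sum>i<k. bush_measure (A i)) = bush_measure (\<Union>i<k. A i)" for k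
  proof (induction k)
    case 0
    show ?case using norm_bush_measure_le[of "{}"] by simp
  next
    case (Suc k)
    have "A i \<inter> A k = {}" if "i < k" for i
      using disjoint_family_onD[OF A(2), of i k] that by simp
    then have "(\<Union>i<k. A i) \<inter> A k = {}" by blast
    then have "bush_measure ((\<Union>i<k. A i) \<union> A k) = bush_measure (\<Union>i<k. A i) + bush_measure (A k)"
      using A(1) by (intro bush_measure_Un) auto
    then show ?case using Suc by (simp add: lessThan_Suc Un_commute add.commute)
  qed
  have "(\<lambda>k. bush_measure (\<Union>i. A i) - (\<Sum>i<k. bush_measure (A i))) \<longlonglongrightarrow> 0"
  proof (rule tendsto_norm_zero_cancel, rule tendsto_sandwich[OF _ _ tendsto_const prob_tail_tendsto_0[OF A(1)]])
    show "\<forall>\<^sub>F k in sequentially. norm (bush_measure (\<Union>i. A i) - (\<Sum>i<k. bush_measure (A i))) \<le> prob ((\<Union>i. A i) - (\<Union>i<k. A i))"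
    proof (intro always_eventually allI)
      fix k
      have "(\<Union>i<k. A i) \<union> ((\<Union>i. A i) - (\<Union>i<k. A i)) = (\<Union>i. A i)" by blast
      then have "bush_measure (\<Union>i. A i) = bush_measure (\<Union>i<k. A i) + bush_measure ((\<Union>i. A i) - (\<Union>i<k. A i))"
        using bush_measure_Un[of "\<Union>i<k. A i" "(\<Union>i. A i) - (\<Union>i<k. A i)"] A(1) by auto
      then have "norm (bush_measure (\<Union>i. A i) - (\<Sum>i<k. bush_measure (A i))) = norm (bush_measure ((\<Union>i. A i) - (\<Union>i<k. A i)))"
        by (simp add: fin)
      also have "\<dots> \<le> prob ((\<Union>i. A i) - (\<Union>i<k. A i))"
        using A(1) by (intro norm_bush_measure_le) auto
      finally show "norm (bush_measure (\<Union>i. A i) - (\<Sum>i<k. bush_measure (A i))) \<le> prob ((\<Union>i. A i) - (\<Union>i<k. A i))" .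
    qed
  qed auto
  from tendsto_diff[OF tendsto_const[of "bush_measure (\<Union>i. A i)"] this]
  show "(\<lambda>i. bush_measure (A i)) sums bush_measure (\<Union>i. A i)" by (simp add: sums_def)
qed

lemma bounded_variation_bush_measure: "bounded_variation_measure M bush_measure"
  unfolding bounded_variation_measure_def
proof (intro exI[of _ 1] allI impI)
  fix P assume P: "finite P" "P \<subseteq> sets M" "partition_on (space M) P"
  have "(\<Sum>E\<in>P. norm (bush_measure E)) \<le> (\<Sum>E\<in>P. prob E)" using P(2) by (intro sum_mono norm_bush_measure_le) auto
  also have "\<dots> = prob (\<Union>E\<in>P. E)"
    using P by (intro finite_measure_finite_Union[symmetric]) (auto simp: partition_on_def disjoint_def disjoint_family_on_def)
  also have "\<dots> \<le> 1" by simp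
  finally show "(\<Sum>E\<in>P. norm (bush_measure E)) \<le> 1" .
qed

lemma continuous_bush_measure: "continuous_wrt_measure M bush_measure"
  unfolding continuous_wrt_measure_def using norm_bush_measure_le by (meson order_le_less_trans)

end

text \<open>For a nonseparable target space the difference of two measurable functions may fail to be
measurable; it does no harm to subtract a function with finitely many values.\<close>
lemma borel_measurable_norm_diff_simple:
  fixes g :: "'w \<Rightarrow> 'x::real_normed_vector"
  assumes g [measurable]: "g \<in> borel_measurable M" and s: "simple_function M s"
  shows "(\<lambda>w. norm (g w - s w)) \<in> borel_measurable M"
proof -
  have [measurable]: "(\<lambda>w. norm (g w - y)) \<in> borel_measurable M" for y
    by (rule measurable_compose[OF g]) (intro borel_measurable_continuous_onI continuous_intros)
  have [measurable]: "{w \<in> space M. s w = y} \<in> sets M" for y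
    using simple_functionD(2)[OF s, of "{y}"] by (simp add: vimage_def Int_def conj_commute)
  have "(\<lambda>w. \<Sum>y\<in>s ` space M. indicator {w \<in> space M. s w = y} w * norm (g w - y)) \<in> borel_measurable M"
    by measurable
  moreover have "(\<Sum>y\<in>s ` space M. indicator {w \<in> space M. s w = y} w * norm (g w - y)) = norm (g w - s w)"
    if "w \<in> space M" for w
  proof -
    have "(\<Sum>y\<in>s ` space M. indicator {w \<in> space M. s w = y} w * norm (g w - y))
        = (\<Sum>y\<in>s ` space M. if y = s w then norm (g w - s w) else 0)"
      using that by (intro sum.cong) auto
    then show ?thesis using that simple_functionD(1)[OF s] by simp
  qed
  ultimately show ?thesis by (simp cong: measurable_cong)
qed

text \<open>The estimate that makes the Bochner integral well defined, for targets that need not be second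
countable.\<close>
lemma norm_simple_bochner_integral_diff_le:
  fixes f :: "'w \<Rightarrow> 'x::real_normed_vector"
  assumes f: "f \<in> borel_measurable M"
    and s: "Bochner_Integration.simple_bochner_integrable M s"
    and t: "Bochner_Integration.simple_bochner_integrable M t"
  shows "ennreal (norm (Bochner_Integration.simple_bochner_integral M s - Bochner_Integration.simple_bochner_integral M t)) \<le>
    (\<integral>\<^sup>+ w. norm (f w - s w) \<partial>M) + (\<integral>\<^sup>+ w. norm (f w - t w) \<partial>M)"
proof -
  have st: "simple_function M s" "simple_function M t"
    using s t by (auto elim: Bochner_Integration.simple_bochner_integrable.cases)
  note [measurable] = borel_measurable_norm_diff_simple[OF f st(1)] borel_measurable_norm_diff_simple[OF f st(2)]
  have diff: "Bochner_Integration.simple_bochner_integrable M (\<lambda>x. s x - t x)"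
    using s t by (rule Bochner_Integration.simple_bochner_integrable_compose2[of "(-)", rotated]) simp
  have "ennreal (norm (Bochner_Integration.simple_bochner_integral M s - Bochner_Integration.simple_bochner_integral M t))
      = norm (Bochner_Integration.simple_bochner_integral M (\<lambda>x. s x - t x))"
    using s t by (subst Bochner_Integration.simple_bochner_integral_diff) auto
  also have "\<dots> \<le> Bochner_Integration.simple_bochner_integral M (\<lambda>x. norm (s x - t x))"
    by (intro ennreal_leI Bochner_Integration.simple_bochner_integral_norm_bound diff)
  also have "\<dots> = (\<integral>\<^sup>+x. norm (s x - t x) \<partial>M)"
    using s t
    by (intro Bochner_Integration.simple_bochner_integral_eq_nn_integral
        Bochner_Integration.simple_bochner_integrable_compose2[of "\<lambda>x y. norm (x - y)"]) auto
  also have "\<dots> \<le> (\<integral>\<^sup>+x. ennreal (norm (f x - s x)) + ennreal (norm (f x - t x)) \<partial>M)"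
    by (auto intro!: nn_integral_mono simp flip: ennreal_plus)
       (metis (no_types) dist_norm dist_triangle3 norm_minus_commute)
  also have "\<dots> = (\<integral>\<^sup>+ w. norm (f w - s w) \<partial>M) + (\<integral>\<^sup>+ w. norm (f w - t w) \<partial>M)"
    by (rule nn_integral_add) auto
  finally show ?thesis .
qed

context cell_bush
begin

text \<open>A density \<open>g\<close> is approximated in mean by a simple function \<open>s\<close>. The indefinite integral of \<open>s\<close> oscillates
less and less between consecutive levels, by \<open>defect_tendsto_0\<close>, and the integral of \<open>g\<close> oscillates
at most by twice the mean distance of \<open>g\<close> and \<open>s\<close> more. This contradicts
\<open>bush_measure_child_deviation\<close> on fine levels.\<close>
lemma no_density: "\<not> (\<exists>g. \<forall>E\<in>sets M. has_strong_bochner_integral M (\<lambda>w. indicator E w *\<^sub>R g w) (bush_measure E))"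
proof
  assume "\<exists>g. \<forall>E\<in>sets M. has_strong_bochner_integral M (\<lambda>w. indicator E w *\<^sub>R g w) (bush_measure E)"
  then obtain g where g: "\<And>E. E \<in> sets M \<Longrightarrow> has_strong_bochner_integral M (\<lambda>w. indicator E w *\<^sub>R g w) (bush_measure E)"
    by blast
  have gE: "(\<lambda>w. indicator E w *\<^sub>R g w) \<in> borel_measurable M" if "E \<in> sets M" for E
    using g[OF that] by (simp add: has_strong_bochner_integral_def)
  have g_meas: "g \<in> borel_measurable M"
    using gE[OF sets.top] by (simp cong: measurable_cong)
  obtain s where s: "Bochner_Integration.simple_bochner_integrable M s"
    and s_close: "(\<integral>\<^sup>+w. norm (g w - s w) \<partial>M) < ennreal (\<eta> / 8)"
  proof -
    obtain s where s: "\<And>i. Bochner_Integration.simple_bochner_integrable M (s i)"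
      and lim: "(\<lambda>i::nat. \<integral>\<^sup>+w. norm (indicator (space M) w *\<^sub>R g w - s i w) \<partial>M) \<longlonglongrightarrow> 0"
      using g[OF sets.top] unfolding has_strong_bochner_integral_def by blast
    have "0 < ennreal (\<eta> / 8)" using \<eta>_pos by simp
    then have "\<forall>\<^sub>F i in sequentially. (\<integral>\<^sup>+w. norm (indicator (space M) w *\<^sub>R g w - s i w) \<partial>M) < ennreal (\<eta> / 8)"
      by (rule order_tendstoD(2)[OF lim])
    then obtain i where "(\<integral>\<^sup>+w. norm (indicator (space M) w *\<^sub>R g w - s i w) \<partial>M) < ennreal (\<eta> / 8)"
      using eventually_happens'[OF sequentially_bot] by blast
    then have "(\<integral>\<^sup>+w. norm (g w - s i w) \<partial>M) < ennreal (\<eta> / 8)"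
      by (simp cong: nn_integral_cong_simp)
    then show thesis using s that by blast
  qed
  have s_simple: "simple_function M s"
    using s by (auto elim: Bochner_Integration.simple_bochner_integrable.cases)
  note [measurable] = borel_measurable_norm_diff_simple[OF g_meas s_simple]
  define \<nu> where "\<nu> = density M (\<lambda>w. ennreal (norm (g w - s w)))"
  have sets_\<nu>: "sets \<nu> = sets M" by (simp add: \<nu>_def)
  have em_\<nu>: "emeasure \<nu> E = (\<integral>\<^sup>+w. ennreal (norm (g w - s w)) * indicator E w \<partial>M)" if "E \<in> sets M" for E
    unfolding \<nu>_def using that by (intro emeasure_density) auto
  have em_space: "emeasure \<nu> (space M) < ennreal (\<eta> / 8)"
    using s_close by (simp add: em_\<nu> cong: nn_integral_cong_simp)
  have fin: "finite_measure \<nu>"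
    using em_space by (intro finite_measureI) (auto simp: \<nu>_def space_density top_unique)
  interpret \<nu>: finite_measure \<nu> by (rule fin)
  have \<nu>_space: "measure \<nu> (space M) \<le> \<eta> / 8"
    using em_space \<eta>_pos by (simp add: \<nu>.emeasure_eq_measure ennreal_less_iff)
  define L where "L y = {w \<in> space M. s w = y}" for y
  have L: "L y \<in> sets M" for y
    using simple_functionD(2)[OF s_simple, of "{y}"] by (simp add: L_def vimage_def Int_def conj_commute)
  define Y where "Y = s ` space M"
  \<comment> \<open>\<open>T\<close> is the indefinite integral of \<open>s\<close>, written through the level sets \<open>L y\<close> of \<open>s\<close>.\<close>
  define T where "T E = (\<Sum>y\<in>Y. prob (L y \<inter> E) *\<^sub>R y)" for E
  have G_T: "norm (bush_measure E - T E) \<le> measure \<nu> E" if E: "E \<in> sets M" for E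
  proof -
    let ?sE = "\<lambda>w. indicator E w *\<^sub>R s w"
    have sE_simple: "simple_function M ?sE"
      using E s_simple by (intro simple_function_compose2[where h = "\<lambda>a b. a *\<^sub>R b"] simple_function_indicator)
    have sE: "Bochner_Integration.simple_bochner_integrable M ?sE"
    proof (rule Bochner_Integration.simple_bochner_integrable.intros)
      show "simple_function M ?sE" by (rule sE_simple)
      show "emeasure M {w \<in> space M. ?sE w \<noteq> 0} \<noteq> \<infinity>" by simp
    qed
    have T: "Bochner_Integration.simple_bochner_integral M ?sE = T E"
      unfolding Bochner_Integration.simple_bochner_integral_def T_def
    proof (rule sum.mono_neutral_cong)
      show "finite Y" using simple_functionD(1)[OF s_simple] by (simp add: Y_def)
      show "finite (?sE ` space M)"
        using simple_functionD(1)[OF sE_simple] .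
      show "prob (L y \<inter> E) *\<^sub>R y = 0" if "y \<in> Y - ?sE ` space M" for y
      proof -
        have "L y \<inter> E = {}" using that by (force simp: L_def)
        then show ?thesis by simp
      qed
      show "prob {w \<in> space M. ?sE w = z} *\<^sub>R z = 0" if "z \<in> ?sE ` space M - Y" for z
        using that by (auto simp: Y_def indicator_def split: if_splits)
      show "prob {w \<in> space M. ?sE w = z} *\<^sub>R z = prob (L z \<inter> E) *\<^sub>R z" if "z \<in> ?sE ` space M \<inter> Y" for z
      proof (cases "z = 0")
        case False
        then have "{w \<in> space M. ?sE w = z} = L z \<inter> E"
          by (auto simp: L_def indicator_def split: if_splits)
        then show ?thesis by simp
      qed simp
    qed
    obtain t where t: "\<And>i. Bochner_Integration.simple_bochner_integrable M (t i)"
      and lim: "(\<lambda>i::nat. \<integral>\<^sup>+w. norm (indicator E w *\<^sub>R g w - t i w) \<partial>M) \<longlonglongrightarrow> 0"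
      and lim_G: "(\<lambda>i. Bochner_Integration.simple_bochner_integral M (t i)) \<longlonglongrightarrow> bush_measure E"
      using g[OF E] unfolding has_strong_bochner_integral_def by blast
    have eq: "(\<integral>\<^sup>+w. norm (indicator E w *\<^sub>R g w - ?sE w) \<partial>M) = emeasure \<nu> E"
      unfolding em_\<nu>[OF E] by (intro nn_integral_cong) (auto simp: indicator_def)
    have le: "ennreal (norm (Bochner_Integration.simple_bochner_integral M (t i) - T E)) \<le>
        (\<integral>\<^sup>+w. norm (indicator E w *\<^sub>R g w - t i w) \<partial>M) + emeasure \<nu> E" for i
      using norm_simple_bochner_integral_diff_le[OF gE[OF E] t[of i] sE] unfolding eq T .
    have l1: "(\<lambda>i. ennreal (norm (Bochner_Integration.simple_bochner_integral M (t i) - T E))) \<longlonglongrightarrow> ennreal (norm (bush_measure E - T E))"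
      by (intro tendsto_intros lim_G)
    have l2: "(\<lambda>i. (\<integral>\<^sup>+w. norm (indicator E w *\<^sub>R g w - t i w) \<partial>M) + emeasure \<nu> E) \<longlonglongrightarrow> 0 + emeasure \<nu> E"
      by (intro tendsto_intros lim)
    have "ennreal (norm (bush_measure E - T E)) \<le> 0 + emeasure \<nu> E"
      by (rule LIMSEQ_le[OF l1 l2]) (use le in blast)
    then show ?thesis by (simp add: \<nu>.emeasure_eq_measure)
  qed
  have bound: "\<eta> / 4 \<le> (\<Sum>y\<in>Y. norm y * defect n (L y))" for n
  proof -
    let ?ch = "\<lambda>j i. c (Suc n) (j * N n + i)"
    have dev: "\<eta> / 2 / Q (Suc n) \<le> (\<Sum>y\<in>Y. norm y * \<bar>prob (L y \<inter> ?ch j i) - prob (L y \<inter> c n j) / N n\<bar>)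
        + (measure \<nu> (space M \<inter> ?ch j i) + measure \<nu> (space M \<inter> c n j) / N n)" if ji: "j < Q n" "i < N n" for j i
    proof -
      have sets: "?ch j i \<in> sets M" "c n j \<in> sets M" using child_sets cell_sets ji by auto
      then have sp: "space M \<inter> ?ch j i = ?ch j i" "space M \<inter> c n j = c n j" using sets.sets_into_space by blast+
      have eq: "T (?ch j i) - (1 / real (N n)) *\<^sub>R T (c n j) = (\<Sum>y\<in>Y. (prob (L y \<inter> ?ch j i) - prob (L y \<inter> c n j) / N n) *\<^sub>R y)"
        by (simp add: T_def scaleR_sum_right scaleR_diff_left sum_subtractf)
      have T_dev: "norm (T (?ch j i) - (1 / real (N n)) *\<^sub>R T (c n j)) \<le> (\<Sum>y\<in>Y. norm y * \<bar>prob (L y \<inter> ?ch j i) - prob (L y \<inter> c n j) / N n\<bar>)"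
        unfolding eq by (rule order_trans[OF norm_sum]) (simp add: mult.commute)
      let ?d = "bush_measure (?ch j i) - (1 / real (N n)) *\<^sub>R bush_measure (c n j)"
      let ?t = "T (?ch j i) - (1 / real (N n)) *\<^sub>R T (c n j)"
      let ?a = "bush_measure (?ch j i) - T (?ch j i)" and ?b = "(1 / real (N n)) *\<^sub>R (bush_measure (c n j) - T (c n j))"
      have d: "?d = ?t + ?a - ?b" by (simp add: scaleR_diff_right)
      have "norm ?d \<le> norm ?t + norm ?a + norm ?b"
        unfolding d using norm_triangle_ineq4[of "?t + ?a" ?b] norm_triangle_ineq[of ?t ?a] by linarith
      moreover have "norm ?b \<le> measure \<nu> (c n j) / N n"
        using G_T[OF sets(2)] by (simp add: divide_right_mono)
      ultimately show ?thesis
        using bush_measure_child_deviation[OF ji] G_T[OF sets(1)] T_dev unfolding sp by linarith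
    qed
    \<comment> \<open>There are \<open>Q (Suc n)\<close> pairs \<open>(j, i)\<close>; the errors due to \<open>\<nu>\<close> add up to twice its total mass.\<close>
    have "\<eta> / 2 = (\<Sum>j<Q n. \<Sum>i<N n. \<eta> / 2 / Q (Suc n))"
      using Q_pos[of n] N_pos[of n] by (simp add: Q_Suc)
    also have "\<dots> \<le> (\<Sum>j<Q n. \<Sum>i<N n. (\<Sum>y\<in>Y. norm y * \<bar>prob (L y \<inter> ?ch j i) - prob (L y \<inter> c n j) / N n\<bar>)
        + (measure \<nu> (space M \<inter> ?ch j i) + measure \<nu> (space M \<inter> c n j) / N n))"
      by (intro sum_mono dev) auto
    also have "\<dots> = (\<Sum>j<Q n. \<Sum>i<N n. \<Sum>y\<in>Y. norm y * \<bar>prob (L y \<inter> ?ch j i) - prob (L y \<inter> c n j) / N n\<bar>)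
        + ((\<Sum>j<Q n. \<Sum>i<N n. measure \<nu> (space M \<inter> ?ch j i)) + (\<Sum>j<Q n. \<Sum>i<N n. measure \<nu> (space M \<inter> c n j) / N n))"
      by (simp only: sum.distrib)
    also have "(\<Sum>j<Q n. \<Sum>i<N n. measure \<nu> (space M \<inter> ?ch j i)) = measure \<nu> (space M)"
      using finite_measure_sum_cells[OF fin sets_\<nu> sets.top, of "Suc n"] unfolding Q_Suc sum_children .
    also have "(\<Sum>j<Q n. \<Sum>i<N n. measure \<nu> (space M \<inter> c n j) / N n) = measure \<nu> (space M)"
      using finite_measure_sum_cells[OF fin sets_\<nu> sets.top, of n] N_pos[of n] by simp
    also have "(\<Sum>j<Q n. \<Sum>i<N n. \<Sum>y\<in>Y. norm y * \<bar>prob (L y \<inter> ?ch j i) - prob (L y \<inter> c n j) / N n\<bar>)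
        = (\<Sum>y\<in>Y. norm y * defect n (L y))"
      unfolding defect_def sum_distrib_left by (simp add: sum.swap[of _ Y])
    finally show ?thesis using \<nu>_space by simp
  qed
  have "(\<lambda>n. \<Sum>y\<in>Y. norm y * defect n (L y)) \<longlonglongrightarrow> (\<Sum>y\<in>Y. norm y * 0)"
    by (intro tendsto_intros defect_tendsto_0 L)
  then have "\<eta> / 4 \<le> (\<Sum>y\<in>Y. norm y * 0)"
    by (rule LIMSEQ_le_const) (use bound in auto)
  then show False using \<eta>_pos by simp
qed

theorem not_radon_nikodym: "\<not> radon_nikodym_property_wrt M TYPE('x)"
  unfolding radon_nikodym_property_wrt_def
  using no_density vector_measure_bush_measure bounded_variation_bush_measure continuous_bush_measure by blast

end

text \<open>The unit interval with the cells $[j/Q_n, (j+1)/Q_n)$ and Lebesgue measure on the \<open>\<sigma>\<close>-algebra that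
they generate.\<close>
lemma cell_filtration_real:
  fixes N Q :: "nat \<Rightarrow> nat"
  assumes N: "\<And>n. N n > 0" and Q_0: "Q 0 = 1" and Q_Suc: "\<And>n. Q (Suc n) = Q n * N n"
  obtains M :: "real measure" and c where "cell_filtration M N Q c"
proof -
  have Q: "Q n > 0" for n by (induction n) (auto simp: Q_0 Q_Suc N)
  define c where "c n j = {real j / Q n ..< real (Suc j) / Q n}" for n j
  \<comment> \<open>Membership in a cell is a matter of integer parts, which reduces the splitting of cells to division by \<open>N n\<close>.\<close>
  have c_iff: "w \<in> c n j \<longleftrightarrow> 0 \<le> w \<and> nat \<lfloor>w * Q n\<rfloor> = j" for w n j
  proof -
    have "w \<in> c n j \<longleftrightarrow> real j \<le> w * Q n \<and> w * Q n < real j + 1"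
      using Q[of n] by (auto simp: c_def field_simps)
    also have "\<dots> \<longleftrightarrow> \<lfloor>w * Q n\<rfloor> = int j" by (simp add: floor_eq_iff)
    also have "\<dots> \<longleftrightarrow> 0 \<le> \<lfloor>w * Q n\<rfloor> \<and> nat \<lfloor>w * Q n\<rfloor> = j" by linarith
    also have "0 \<le> \<lfloor>w * Q n\<rfloor> \<longleftrightarrow> 0 \<le> w" using Q[of n] by (simp add: zero_le_mult_iff)
    finally show ?thesis .
  qed
  have c_sub: "c n j \<subseteq> {0..<1}" if "j < Q n" for n j
  proof -
    have "real (Suc j) / Q n \<le> 1" using that Q[of n] by (simp add: divide_le_eq)
    moreover have "0 \<le> real j / Q n" by simp
    ultimately show ?thesis unfolding c_def by auto
  qed
  define U where "U = restrict_space lborel {0..<1::real}"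
  define F where "F = sigma {0..<1::real} (insert {} {c n j | n j. j < Q n})"
  have gen: "insert {} {c n j | n j. j < Q n} \<subseteq> Pow {0..<1}" using c_sub by auto
  have F: "sets F = sigma_sets {0..<1} (insert {} {c n j | n j. j < Q n})" "space F = {0..<1}"
    unfolding F_def using gen by (auto simp: sets_measure_of space_measure_of)
  have c_U: "c n j \<in> sets U" if "j < Q n" for n j
    unfolding U_def using c_sub[OF that] by (simp add: sets_restrict_space_iff) (simp add: c_def)
  have sub: "subalgebra U F"
    unfolding subalgebra_def
  proof
    show "space F = space U" by (simp add: F U_def space_restrict_space)
    have "sigma_sets (space U) (insert {} {c n j | n j. j < Q n}) \<subseteq> sets U"
      using c_U by (intro sets.sigma_sets_subset) auto
    then show "sets F \<subseteq> sets U" by (simp add: F U_def space_restrict_space)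
  qed
  define M where "M = restr_to_subalg U F"
  have em: "emeasure M A = emeasure lborel A" if "A \<in> sets F" for A
  proof -
    have "A \<in> sets U" using that sub by (auto simp: subalgebra_def)
    then show ?thesis
      unfolding M_def emeasure_restr_to_subalg[OF sub that] unfolding U_def
      by (subst emeasure_restrict_space) (auto simp: sets_restrict_space_iff)
  qed
  have space_M: "space M = {0..<1}" by (simp add: M_def space_restr_to_subalg U_def space_restrict_space)
  have sets_M: "sets M = sets F" by (simp add: M_def sets_restr_to_subalg[OF sub])
  interpret prob_space M
  proof
    have "emeasure M (space F) = emeasure lborel (space F)" by (rule em) simp
    then show "emeasure M (space M) = 1" by (simp add: F space_M)
  qed
  have "cell_filtration M N Q c"
  proof
    show "sets M = sigma_sets (space M) (insert {} {c n j | n j. j < Q n})"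
      by (simp add: sets_M space_M F)
    show "prob (c n j) = 1 / real (Q n)" if "j < Q n" for n j
    proof -
      have "c n j \<in> sets F" unfolding F using that by (intro sigma_sets.Basic) auto
      then have "emeasure M (c n j) = ennreal (1 / real (Q n))"
        using Q[of n] by (simp add: em c_def divide_right_mono diff_divide_distrib[symmetric])
      then show ?thesis by (simp add: measure_eq_emeasure_eq_ennreal)
    qed
    show "c 0 0 = space M" by (simp add: c_def Q_0 space_M)
    show "c n j = (\<Union>i<N n. c (Suc n) (j * N n + i))" for n j
    proof -
      have "nat \<lfloor>w * Q n\<rfloor> = nat \<lfloor>w * Q (Suc n)\<rfloor> div N n" if "0 \<le> w" for w :: real
      proof -
        have "w * Q n = w * Q (Suc n) / N n" using N[of n] by (simp add: Q_Suc)
        then have "\<lfloor>w * Q n\<rfloor> = \<lfloor>w * Q (Suc n)\<rfloor> div int (N n)"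
          using floor_divide_real_eq_div[of "int (N n)" "w * Q (Suc n)"] by simp
        then show ?thesis using that by (simp add: nat_div_distrib)
      qed
      then have "w \<in> c n j \<longleftrightarrow> (\<exists>i<N n. w \<in> c (Suc n) (j * N n + i))" for w
        unfolding c_iff using N[of n]
        by (auto intro!: exI[of _ "nat \<lfloor>w * Q (Suc n)\<rfloor> mod N n"])
      then show ?thesis by auto
    qed
    show "c n i \<inter> c n j = {}" if "i \<noteq> j" for n i j
      using that c_iff by auto
  qed (use N Q_0 Q_Suc in auto)
  then show thesis by (rule that)
qed

text \<open>Convex combinations are replaced by averages of finitely many points, with a common number \<open>k\<close> of
points for the finitely many nodes of a level, so that the tree lives on cells of equal length.
Half of the admissible error is spent on this replacement.\<close>
theorem radon_nikodym_no_bush: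
  fixes P :: "nat \<Rightarrow> 'x::banach set"
  assumes rnp: "radon_nikodym_property TYPE('x)" and \<eta>: "\<eta> > 0"
    and bdd: "\<And>n x. x \<in> P n \<Longrightarrow> norm x \<le> 1"
    and start: "P 0 \<noteq> {}"
    and branch: "\<And>n x. x \<in> P n \<Longrightarrow> \<exists>y\<in>convex hull (P (Suc n) - ball x \<eta>). dist x y < \<eta> / 2 ^ (n + 4)"
  shows False
proof -
  let ?good = "\<lambda>(n::nat) (q::nat, f::nat \<Rightarrow> 'x). q > 0 \<and> (n = 0 \<longrightarrow> q = 1) \<and> (\<forall>j<q. f j \<in> P n)"
  let ?child = "\<lambda>(n::nat) (q::nat, f::nat \<Rightarrow> 'x) (q'::nat, f'::nat \<Rightarrow> 'x). \<exists>k>0. q' = q * k \<and> (\<forall>j<q.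
      norm (f j - (1 / real k) *\<^sub>R (\<Sum>i<k. f' (j * k + i))) \<le> \<eta> / 2 ^ (n + 3) \<and>
      (\<forall>i<k. \<eta> \<le> norm (f' (j * k + i) - f j)))"
  have "\<exists>s. \<forall>n. ?good n (s n) \<and> ?child n (s n) (s (Suc n))"
  proof (rule dependent_nat_choice)
    obtain x where "x \<in> P 0" using start by blast
    then show "\<exists>s. ?good 0 s" by (intro exI[of _ "(1::nat, \<lambda>_. x)"]) auto
  next
    fix s n assume good: "?good n s"
    obtain q f where s: "s = (q, f)" by (cases s)
    have q: "q > 0" and f: "\<And>j. j < q \<Longrightarrow> f j \<in> P n" using good by (auto simp: s)
    let ?e = "\<eta> / 2 ^ (n + 4)"
    have e: "?e > 0" using \<eta> by simp
    obtain y where y: "\<And>j. j < q \<Longrightarrow> y j \<in> convex hull (P (Suc n) - ball (f j) \<eta>)"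
      and fy: "\<And>j. j < q \<Longrightarrow> dist (f j) (y j) < ?e"
      using branch[OF f] by metis
    obtain k xs where k: "k > 0" and xs: "\<And>j. j < q \<Longrightarrow> length (xs j) = k \<and>
        set (xs j) \<subseteq> P (Suc n) - ball (f j) \<eta> \<and> norm (y j - average (xs j)) < ?e"
      using finite_common_length_averages[of q y "\<lambda>j. P (Suc n) - ball (f j) \<eta>", OF y e] by blast
    define f' where "f' m = xs (m div k) ! (m mod k)" for m
    have f'_child: "f' (j * k + i) = xs j ! i" if "i < k" for j i
      using that k by (simp add: f'_def)
    have mem: "f' (j * k + i) \<in> P (Suc n) - ball (f j) \<eta>" if "j < q" "i < k" for j i
    proof -
      have "xs j ! i \<in> set (xs j)" using xs[OF that(1)] that(2) by (intro nth_mem) simp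
      then show ?thesis using xs[OF that(1)] unfolding f'_child[OF that(2)] by blast
    qed
    have "norm (f j - (1 / real k) *\<^sub>R (\<Sum>i<k. f' (j * k + i))) \<le> \<eta> / 2 ^ (n + 3)" if j: "j < q" for j
    proof -
      have "(\<Sum>i<k. f' (j * k + i)) = sum_list (xs j)"
        using xs[OF j] by (simp add: f'_child sum_list_sum_nth atLeast0LessThan)
      then have avg: "(1 / real k) *\<^sub>R (\<Sum>i<k. f' (j * k + i)) = average (xs j)"
        using xs[OF j] by (simp add: average_def)
      have "norm (f j - average (xs j)) \<le> norm (f j - y j) + norm (y j - average (xs j))"
        by (rule norm_diff_triangle_le[OF order_refl order_refl])
      also have "\<dots> \<le> ?e + ?e" using fy[OF j] xs[OF j] by (simp add: dist_norm)
      also have "\<dots> = \<eta> / 2 ^ (n + 3)" by (simp add: power_add)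
      finally show ?thesis unfolding avg .
    qed
    moreover have "\<eta> \<le> norm (f' (j * k + i) - f j)" if "j < q" "i < k" for j i
      using mem[OF that] by (simp add: dist_norm norm_minus_commute)
    ultimately have "?child n s (q * k, f')"
      using k by (auto simp: s)
    moreover have "?good (Suc n) (q * k, f')"
      using q k mem by (auto elim!: child_index)
    ultimately show "\<exists>s'. ?good (Suc n) s' \<and> ?child n s s'" by blast
  qed
  then obtain s where s_all: "\<forall>n. ?good n (s n) \<and> ?child n (s n) (s (Suc n))" by (rule exE)
  have good: "?good n (s n)" for n by (rule conjunct1[OF spec[OF s_all]])
  have child: "?child n (s n) (s (Suc n))" for n by (rule conjunct2[OF spec[OF s_all]])
  define Q where "Q n = fst (s n)" for n
  define v where "v n = snd (s n)" for n
  have s: "s n = (Q n, v n)" for n by (simp add: Q_def v_def)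
  have "\<forall>n. \<exists>k. k > 0 \<and> Q (Suc n) = Q n * k \<and> (\<forall>j<Q n.
      norm (v n j - (1 / real k) *\<^sub>R (\<Sum>i<k. v (Suc n) (j * k + i))) \<le> \<eta> / 2 ^ (n + 3) \<and>
      (\<forall>i<k. \<eta> \<le> norm (v (Suc n) (j * k + i) - v n j)))"
    using child by (simp add: s)
  then obtain N where N_v: "\<forall>n. N n > 0 \<and> Q (Suc n) = Q n * N n \<and> (\<forall>j<Q n.
      norm (v n j - (1 / real (N n)) *\<^sub>R (\<Sum>i<N n. v (Suc n) (j * N n + i))) \<le> \<eta> / 2 ^ (n + 3) \<and>
      (\<forall>i<N n. \<eta> \<le> norm (v (Suc n) (j * N n + i) - v n j)))"
    by (rule choice[THEN exE])
  note N_v = spec[OF N_v]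
  have N: "N n > 0" "Q (Suc n) = Q n * N n" for n
    by (rule conjunct1[OF N_v], rule conjunct1[OF conjunct2[OF N_v]])
  have v: "norm (v n j - (1 / real (N n)) *\<^sub>R (\<Sum>i<N n. v (Suc n) (j * N n + i))) \<le> \<eta> / 2 ^ (n + 3)"
    if "j < Q n" for n j
    using conjunct2[OF conjunct2[OF N_v[of n]]] that by simp
  have v_apart: "\<eta> \<le> norm (v (Suc n) (j * N n + i) - v n j)" if "j < Q n" "i < N n" for n i j
    using conjunct2[OF conjunct2[OF N_v[of n]]] that by simp
  have Q_0: "Q 0 = 1" using good[of 0] by (simp add: s)
  have v_P: "v n j \<in> P n" if "j < Q n" for n j using good[of n] that by (simp add: s)
  obtain M :: "real measure" and c where cells: "cell_filtration M N Q c"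
    using cell_filtration_real[OF N(1) Q_0 N(2)] .
  interpret cell_filtration M N Q c by (rule cells)
  interpret cell_bush M N Q c v \<eta>
  proof
    show "norm (v n j) \<le> 1" if "j < Q n" for n j by (rule bdd[OF v_P[OF that]])
  qed (fact \<eta> | erule v | erule v_apart, assumption)+
  show False
    using not_radon_nikodym rnp finite_measure_axioms unfolding radon_nikodym_property_def by blast
qed

section \<open>Strongly exposing functionals\<close>

lemma norm_blinfun_le_ball:
  fixes g :: "'x::real_normed_vector \<Rightarrow>\<^sub>L real"
  assumes "\<And>y. norm y \<le> 1 \<Longrightarrow> blinfun_apply g y \<le> B"
  shows "norm g \<le> B"
proof (rule norm_blinfun_bound)
  show "0 \<le> B" using assms[of 0] by simp
  fix y :: 'x
  show "norm (blinfun_apply g y) \<le> B * norm y"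
  proof (cases "y = 0")
    case False
    let ?u = "(1 / norm y) *\<^sub>R y"
    have "blinfun_apply g ?u \<le> B" "blinfun_apply g (- ?u) \<le> B"
      using False by (intro assms; simp)+
    then show ?thesis using False by (simp add: blinfun.scaleR_right blinfun.minus_right field_simps abs_le_iff)
  qed simp
qed

lemma blinfun_le_norm:
  fixes g :: "'x::real_normed_vector \<Rightarrow>\<^sub>L real"
  assumes "norm y \<le> 1"
  shows "blinfun_apply g y \<le> norm g" and "- norm g \<le> blinfun_apply g y"
proof -
  have "\<bar>blinfun_apply g y\<bar> \<le> norm g * norm y" using norm_blinfun[of g y] by simp
  also have "\<dots> \<le> norm g" using assms by (simp add: mult_left_le)
  finally show "blinfun_apply g y \<le> norm g" "- norm g \<le> blinfun_apply g y" by auto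
qed

definition slice :: "('x::real_normed_vector \<Rightarrow>\<^sub>L real) \<Rightarrow> real \<Rightarrow> 'x set" where
  "slice g \<alpha> = {x. norm x \<le> 1 \<and> norm g - \<alpha> < blinfun_apply g x}"

definition has_small_slice :: "real \<Rightarrow> ('x::real_normed_vector \<Rightarrow>\<^sub>L real) \<Rightarrow> bool" where
  "has_small_slice e g \<longleftrightarrow> (\<exists>\<alpha>>0. \<forall>x\<in>slice g \<alpha>. \<forall>y\<in>slice g \<alpha>. norm (x - y) < e)"

lemma slice_nonempty:
  assumes "\<alpha> > 0"
  shows "slice g \<alpha> \<noteq> {}"
proof
  assume empty: "slice g \<alpha> = {}"
  have "norm g \<le> norm g - \<alpha>"
  proof (rule norm_blinfun_le_ball)
    fix y assume "norm (y :: 'a) \<le> 1"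
    then show "blinfun_apply g y \<le> norm g - \<alpha>" using empty by (force simp: slice_def)
  qed
  then show False using assms by simp
qed

lemma slice_perturb:
  assumes "norm (g' - g) \<le> \<delta>"
  shows "slice g' \<alpha> \<subseteq> slice g (\<alpha> + 2 * \<delta>)"
proof
  fix x assume "x \<in> slice g' \<alpha>"
  then have x: "norm x \<le> 1" "norm g' - \<alpha> < blinfun_apply g' x" by (auto simp: slice_def)
  have "blinfun_apply g' x - blinfun_apply g x \<le> \<delta>"
    using blinfun_le_norm(1)[OF x(1), of "g' - g"] assms by (simp add: blinfun.diff_left)
  moreover have "norm g - norm g' \<le> \<delta>"
    using norm_triangle_ineq2[of g g'] assms by (simp add: norm_minus_commute)
  ultimately show "x \<in> slice g (\<alpha> + 2 * \<delta>)" using x by (simp add: slice_def)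
qed

lemma open_has_small_slice: "open (Collect (has_small_slice e))"
  unfolding open_dist
proof
  fix g :: "'a \<Rightarrow>\<^sub>L real" assume "g \<in> Collect (has_small_slice e)"
  then obtain \<alpha> where \<alpha>: "\<alpha> > 0" "\<forall>x\<in>slice g \<alpha>. \<forall>y\<in>slice g \<alpha>. norm (x - y) < e"
    by (auto simp: has_small_slice_def)
  have "has_small_slice e g'" if "dist g' g < \<alpha> / 4" for g'
  proof -
    have "slice g' (\<alpha> / 2) \<subseteq> slice g (\<alpha> / 2 + 2 * (\<alpha> / 4))"
      using that by (intro slice_perturb) (simp add: dist_norm)
    then have "slice g' (\<alpha> / 2) \<subseteq> slice g \<alpha>" by simp
    then show ?thesis
      unfolding has_small_slice_def using \<alpha> by (intro exI[of _ "\<alpha> / 2"]) auto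
  qed
  then show "\<exists>d>0. \<forall>g'. dist g' g < d \<longrightarrow> g' \<in> Collect (has_small_slice e)"
    using \<alpha>(1) by (intro exI[of _ "\<alpha> / 4"]) simp
qed

definition near_maximizers :: "('x::real_normed_vector \<Rightarrow>\<^sub>L real) \<Rightarrow> real \<Rightarrow> real \<Rightarrow> 'x set" where
  "near_maximizers f r \<alpha> = (\<Union>g\<in>cball f r. slice g \<alpha>)"

text \<open>Otherwise some \<open>h\<close> in the dual ball separates \<open>x\<close> from all near maximisers outside \<open>ball x \<eta>\<close>. But if \<open>x\<close>
almost maximises \<open>g\<close>, then every point that almost maximises \<open>g + t h\<close> has nearly the value \<open>h x\<close> under \<open>h\<close>
or a larger one, by comparison with \<open>x\<close>; and as the slices of \<open>g + t h\<close> are large, one of these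
points is far from \<open>x\<close>.\<close>
lemma near_maximizer_branches:
  assumes large: "\<And>g. g \<in> ball f \<epsilon> \<Longrightarrow> \<not> has_small_slice (2 * \<eta>) g"
    and x: "x \<in> near_maximizers f r \<alpha>" and t: "t > 0" "r + t < \<epsilon>" and \<beta>: "\<beta> > 0"
    and d: "(\<alpha> + \<beta>) / t < d"
  shows "\<exists>y\<in>convex hull (near_maximizers f (r + t) \<beta> - ball x \<eta>). dist x y < d"
proof -
  let ?S = "near_maximizers f (r + t) \<beta> - ball x \<eta>"
  obtain g where g: "dist f g \<le> r" "norm x \<le> 1" "norm g - \<alpha> < blinfun_apply g x"
    using x by (auto simp: near_maximizers_def slice_def)
  \<comment> \<open>The case \<open>h = 0\<close> is used below to see that there are near maximisers far from \<open>x\<close> at all.\<close>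
  have far: "\<exists>y\<in>?S. blinfun_apply h x - (\<alpha> + \<beta>) / t \<le> blinfun_apply h y" if h: "norm h \<le> 1" for h
  proof -
    let ?g = "g + t *\<^sub>R h"
    have "dist g ?g \<le> t" using h t(1) by (simp add: dist_norm mult_left_le)
    then have near: "dist f ?g \<le> r + t" using g(1) dist_triangle[of f ?g g] by linarith
    then have "\<not> has_small_slice (2 * \<eta>) ?g" using large t(2) by simp
    then obtain y1 y2 where y12: "y1 \<in> slice ?g \<beta>" "y2 \<in> slice ?g \<beta>" "2 * \<eta> \<le> norm (y1 - y2)"
      using \<beta> unfolding has_small_slice_def by (meson not_le)
    have "norm (y1 - y2) \<le> dist x y1 + dist x y2"
      using dist_triangle3[of y1 y2 x] by (simp add: dist_norm dist_commute)
    then obtain y where y: "y \<in> slice ?g \<beta>" "\<eta> \<le> dist x y"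
      using y12 by (metis add_le_cancel_left le_cases mult_2 order_trans add_mono not_le add_strict_mono)
    have "y \<in> ?S" using y near by (auto simp: near_maximizers_def)
    moreover have "blinfun_apply h x - (\<alpha> + \<beta>) / t \<le> blinfun_apply h y"
    proof -
      have "blinfun_apply ?g x \<le> norm ?g" by (rule blinfun_le_norm(1)[OF g(2)])
      moreover have "norm ?g - \<beta> < blinfun_apply ?g y" "norm y \<le> 1" using y(1) by (auto simp: slice_def)
      moreover have "blinfun_apply g y \<le> norm g" using \<open>norm y \<le> 1\<close> by (rule blinfun_le_norm(1))
      ultimately have "t * blinfun_apply h x - (\<alpha> + \<beta>) \<le> t * blinfun_apply h y"
        using g(3) by (simp add: blinfun.add_left blinfun.scaleR_left)
      then show ?thesis using t(1) by (simp add: field_simps)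
    qed
    ultimately show ?thesis by blast
  qed
  show ?thesis
  proof (rule ccontr)
    assume "\<not> ?thesis"
    then have dist: "d \<le> dist x y" if "y \<in> convex hull ?S" for y using that by (meson not_le)
    have "?S \<noteq> {}" using far[of 0] by auto
    then have "convex hull ?S \<noteq> {}" by simp
    then obtain h where h: "norm h \<le> 1" "\<And>y. y \<in> convex hull ?S \<Longrightarrow> blinfun_apply h y + d \<le> blinfun_apply h x"
      using separate_point_from_convex[OF convex_convex_hull _ dist] by metis
    obtain y where "y \<in> ?S" "blinfun_apply h x - (\<alpha> + \<beta>) / t \<le> blinfun_apply h y"
      using far[OF h(1)] by blast
    then show False using h(2)[OF hull_inc] d by fastforce
  qed
qed

text \<open>If every functional near \<open>f\<close> had large slices only, the near maximisers would form a bush by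
\<open>near_maximizer_branches\<close>. The radii \<open>r n\<close> increase to \<open>\<epsilon>\<close>, so that level \<open>n\<close> may use a perturbation of size
\<open>t n\<close>, and the widths \<open>\<alpha> n\<close> shrink fast enough for the quotients by \<open>t n\<close> to stay below the errors allowed
in a bush.\<close>
lemma dense_has_small_slice:
  fixes f :: "'x::banach \<Rightarrow>\<^sub>L real"
  assumes rnp: "radon_nikodym_property TYPE('x)" and \<epsilon>: "\<epsilon> > 0" and e: "e > 0"
  shows "\<exists>g\<in>ball f \<epsilon>. has_small_slice e g"
proof (rule ccontr)
  assume contr: "\<not> ?thesis"
  define \<eta> where "\<eta> = e / 2"
  have \<eta>: "\<eta> > 0" using e by (simp add: \<eta>_def)
  have large: "\<not> has_small_slice (2 * \<eta>) g" if "g \<in> ball f \<epsilon>" for g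
    using contr that by (auto simp: \<eta>_def)
  define \<alpha> where "\<alpha> n = \<epsilon> * \<eta> / (128 * 4 ^ n)" for n :: nat
  define t where "t n = \<epsilon> / (2 * 2 ^ n)" for n :: nat
  define r where "r n = \<epsilon> - \<epsilon> / 2 ^ n" for n :: nat
  show False
  proof (rule radon_nikodym_no_bush[OF rnp \<eta>])
    show "norm x \<le> 1" if "x \<in> near_maximizers f (r n) (\<alpha> n)" for n x
      using that by (auto simp: near_maximizers_def slice_def)
    have "slice f (\<alpha> 0) \<noteq> {}" using \<epsilon> \<eta> by (intro slice_nonempty) (simp add: \<alpha>_def)
    then show "near_maximizers f (r 0) (\<alpha> 0) \<noteq> {}"
      by (auto simp: near_maximizers_def r_def)
    fix n x assume x: "x \<in> near_maximizers f (r n) (\<alpha> n)"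
    have r_Suc: "r n + t n = r (Suc n)" by (simp add: r_def t_def)
    have "(4::real) ^ n = 2 ^ n * 2 ^ n" by (simp add: power_mult_distrib[symmetric])
    then have "(\<alpha> n + \<alpha> (Suc n)) / t n = 5 * \<eta> / (256 * 2 ^ n)"
      using \<epsilon> by (simp add: \<alpha>_def t_def field_simps)
    also have "\<dots> < \<eta> / 2 ^ (n + 4)"
      using \<eta> by (simp add: power_add field_simps)
    finally have "(\<alpha> n + \<alpha> (Suc n)) / t n < \<eta> / 2 ^ (n + 4)" .
    then have "\<exists>y\<in>convex hull (near_maximizers f (r n + t n) (\<alpha> (Suc n)) - ball x \<eta>). dist x y < \<eta> / 2 ^ (n + 4)"
      using \<epsilon> \<eta> by (intro near_maximizer_branches[OF large x]) (auto simp: t_def \<alpha>_def r_Suc r_def)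
    then show "\<exists>y\<in>convex hull (near_maximizers f (r (Suc n)) (\<alpha> (Suc n)) - ball x \<eta>). dist x y < \<eta> / 2 ^ (n + 4)"
      unfolding r_Suc .
  qed
qed

text \<open>The slices form a filter base of sets of arbitrarily small diameter, so by completeness they
converge to a point, which \<open>g\<close> then strongly exposes.\<close>
lemma strongly_exposed_if_small_slices:
  fixes g :: "'x::banach \<Rightarrow>\<^sub>L real"
  assumes small: "\<And>e. e > 0 \<Longrightarrow> has_small_slice e g" and nontrivial: "(u::'x) \<noteq> 0"
  obtains x where "strongly_exposed_point x" "blinfun_apply g x = norm g"
proof -
  have g: "g \<noteq> 0"
  proof
    assume "g = 0"
    obtain \<alpha> where \<alpha>: "\<alpha> > 0" "\<forall>x\<in>slice g \<alpha>. \<forall>y\<in>slice g \<alpha>. norm (x - y) < 1"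
      using small[of 1] by (auto simp: has_small_slice_def)
    let ?v = "(1 / norm u) *\<^sub>R u"
    have "?v \<in> slice g \<alpha>" "- ?v \<in> slice g \<alpha>"
      using \<alpha>(1) nontrivial by (auto simp: slice_def \<open>g = 0\<close>)
    then have "norm (?v - (- ?v)) < 1" using \<alpha>(2) by blast
    moreover have "?v - (- ?v) = 2 *\<^sub>R ?v" by (simp add: scaleR_left_distrib[symmetric] divide_simps)
    ultimately show False using nontrivial by simp
  qed
  have conv: "\<forall>\<^sub>F n in sequentially. X n \<in> slice g \<alpha>"
    if "\<And>n. norm (X n) \<le> 1" "(\<lambda>n. blinfun_apply g (X n)) \<longlonglongrightarrow> norm g" "\<alpha> > 0" for X :: "nat \<Rightarrow> 'x" and \<alpha>
    using order_tendstoD(1)[OF that(2), of "norm g - \<alpha>"] that(1,3) by (simp add: slice_def)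
  have "\<exists>x. x \<in> slice g (inverse (real (Suc n)))" for n
    using slice_nonempty[of "inverse (real (Suc n))" g] by auto
  then obtain X where X: "\<And>n. X n \<in> slice g (inverse (real (Suc n)))" by metis
  have X_ball: "norm (X n) \<le> 1" for n using X[of n] by (simp add: slice_def)
  have gX: "(\<lambda>n. blinfun_apply g (X n)) \<longlonglongrightarrow> norm g"
  proof (rule tendsto_sandwich)
    show "\<forall>\<^sub>F n in sequentially. norm g - inverse (real (Suc n)) \<le> blinfun_apply g (X n)"
      using X by (auto simp: slice_def less_imp_le)
    show "\<forall>\<^sub>F n in sequentially. blinfun_apply g (X n) \<le> norm g"
      by (intro always_eventually allI blinfun_le_norm(1) X_ball)
    show "(\<lambda>n. norm g - inverse (real (Suc n))) \<longlonglongrightarrow> norm g"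
      using tendsto_diff[OF tendsto_const LIMSEQ_inverse_real_of_nat, of "norm g"] by simp
  qed simp
  have "Cauchy X"
  proof (rule metric_CauchyI)
    fix e :: real assume "e > 0"
    then obtain \<alpha> where \<alpha>: "\<alpha> > 0" "\<forall>x\<in>slice g \<alpha>. \<forall>y\<in>slice g \<alpha>. norm (x - y) < e"
      using small[of e] by (auto simp: has_small_slice_def)
    obtain n0 where "\<And>n. n \<ge> n0 \<Longrightarrow> X n \<in> slice g \<alpha>"
      using conv[OF X_ball gX \<alpha>(1)] by (auto simp: eventually_sequentially)
    then show "\<exists>n0. \<forall>m\<ge>n0. \<forall>n\<ge>n0. dist (X m) (X n) < e"
      using \<alpha>(2) unfolding dist_norm by blast
  qed
  then obtain x where x: "X \<longlonglongrightarrow> x" by (auto simp: Cauchy_convergent_iff convergent_def)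
  have "norm x \<le> 1" by (rule Lim_norm_ubound[OF _ x]) (auto simp: X_ball)
  have gx: "blinfun_apply g x = norm g"
    by (rule LIMSEQ_unique[OF _ gX]) (intro tendsto_intros x)
  have "norm g \<le> norm g * norm x" using norm_blinfun[of g x] gx by simp
  then have norm_x: "norm x = 1" using g \<open>norm x \<le> 1\<close> by simp
  have "strongly_exposed_point x"
    unfolding strongly_exposed_point_def
  proof (intro conjI exI[of _ "(1 / norm g) *\<^sub>R g"] allI impI)
    show "x \<in> sphere 0 1" "(1 / norm g) *\<^sub>R g \<in> sphere 0 1" "blinfun_apply ((1 / norm g) *\<^sub>R g) x = 1"
      using norm_x g gx by (auto simp: blinfun.scaleR_left)
    fix Y :: "nat \<Rightarrow> 'x"
    assume Y: "range Y \<subseteq> cball 0 1" and lim: "(\<lambda>n. blinfun_apply ((1 / norm g) *\<^sub>R g) (Y n)) \<longlonglongrightarrow> 1"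
    have Y_ball: "norm (Y n) \<le> 1" for n using Y by (auto simp: image_subset_iff)
    have gY: "(\<lambda>n. blinfun_apply g (Y n)) \<longlonglongrightarrow> norm g"
      using tendsto_mult[OF tendsto_const[of "norm g"] lim] g by (simp add: blinfun.scaleR_left)
    show "Y \<longlonglongrightarrow> x"
    proof (rule metric_LIMSEQ_I)
      fix e :: real assume "e > 0"
      then obtain \<alpha> where \<alpha>: "\<alpha> > 0" "\<forall>x\<in>slice g \<alpha>. \<forall>y\<in>slice g \<alpha>. norm (x - y) < e"
        using small[of e] by (auto simp: has_small_slice_def)
      have "x \<in> slice g \<alpha>" using \<alpha>(1) norm_x gx by (simp add: slice_def)
      moreover obtain n0 where "\<And>n. n \<ge> n0 \<Longrightarrow> Y n \<in> slice g \<alpha>"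
        using conv[OF Y_ball gY \<alpha>(1)] by (auto simp: eventually_sequentially)
      ultimately show "\<exists>n0. \<forall>n\<ge>n0. dist (Y n) x < e"
        using \<alpha>(2) unfolding dist_norm by blast
    qed
  qed
  then show thesis using gx by (rule that)
qed

text \<open>The Bourgain-Phelps theorem for the unit ball. By Baire's theorem in the dual space, the functionals
with slices of diameter below $1/(n+1)$ for all \<open>n\<close> are dense.\<close>
theorem dense_strongly_exposing:
  fixes f :: "'x::banach \<Rightarrow>\<^sub>L real"
  assumes rnp: "radon_nikodym_property TYPE('x)" and nontrivial: "(u::'x) \<noteq> 0" and \<epsilon>: "\<epsilon> > 0"
  obtains g x where "dist f g < \<epsilon>" "strongly_exposed_point x" "blinfun_apply g x = norm g"
proof -
  let ?O = "\<lambda>n. Collect (has_small_slice (inverse (real (Suc n)))) :: ('x \<Rightarrow>\<^sub>L real) set"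
  have dense: "closure (?O n) = UNIV" for n
  proof -
    have "f \<in> closure (?O n)" for f
      unfolding closure_approachable
    proof (intro allI impI)
      fix e :: real assume "e > 0"
      then obtain g where "g \<in> ball f e" "has_small_slice (inverse (real (Suc n))) g"
        using dense_has_small_slice[OF rnp, of e "inverse (real (Suc n))" f] by auto
      then show "\<exists>g\<in>?O n. dist g f < e"
        by (intro bexI[of _ g]) (auto simp: dist_commute)
    qed
    then show ?thesis by blast
  qed
  have "Met_TC.mtopology closure_of \<Inter>(range ?O) = UNIV"
    using dense open_has_small_slice
    by (intro Met_TC.metric_Baire_category) (auto simp: complete_UNIV)
  then have "f \<in> closure (\<Inter>(range ?O))" by simp
  then obtain g where "g \<in> \<Inter>(range ?O)" and g_f: "dist g f < \<epsilon>"
    using \<epsilon> unfolding closure_approachable by blast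
  then have g: "has_small_slice (inverse (real (Suc n))) g" for n by blast
  have "has_small_slice e g" if e: "e > 0" for e
  proof -
    obtain n where "inverse (real (Suc n)) < e" using reals_Archimedean[OF e] by blast
    then show ?thesis using g[of n] unfolding has_small_slice_def by (meson order.strict_trans)
  qed
  then obtain x where "strongly_exposed_point x" "blinfun_apply g x = norm g"
    using strongly_exposed_if_small_slices nontrivial by metis
  then show thesis using that g_f by (simp add: dist_commute)
qed

section \<open>The ball covering property of a dual space\<close>

lemma ball_covering_propertyI_countable:
  fixes A :: "('z::real_normed_vector \<times> real) set"
  assumes A: "countable A" "A \<noteq> {}"
    and good: "\<And>z r. (z, r) \<in> A \<Longrightarrow> z \<noteq> 0 \<and> 0 < r \<and> r \<le> norm z"
    and cover: "\<And>u. norm u = 1 \<Longrightarrow> \<exists>(z, r)\<in>A. dist z u < r"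
  shows "ball_covering_property TYPE('z)"
proof -
  have range: "range (from_nat_into A) = A" using A by (intro range_from_nat_into)
  have mem: "(fst (from_nat_into A n), snd (from_nat_into A n)) \<in> A" for n
    using from_nat_into[OF A(2), of n] by simp
  show ?thesis
    unfolding ball_covering_property_def
  proof (intro exI conjI allI)
    fix n
    show "fst (from_nat_into A n) \<noteq> 0" "0 < snd (from_nat_into A n)"
      "snd (from_nat_into A n) \<le> norm (fst (from_nat_into A n))"
      using good[OF mem[of n]] by auto
  next
    show "sphere 0 1 \<subseteq> (\<Union>n. ball (fst (from_nat_into A n)) (snd (from_nat_into A n)))"
    proof
      fix u :: 'z assume "u \<in> sphere 0 1"
      then obtain z r where zr: "(z, r) \<in> A" "dist z u < r" using cover[of u] by auto
      then obtain n where "from_nat_into A n = (z, r)" using range by (metis imageE)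
      then show "u \<in> (\<Union>n. ball (fst (from_nat_into A n)) (snd (from_nat_into A n)))"
        using zr(2) by (intro UN_I[of n]) auto
    qed
  qed
qed

lemma ball_covering_property_isometry:
  fixes T :: "'a::real_normed_vector \<Rightarrow> 'b::real_normed_vector"
  assumes T: "linear T" "\<And>x. norm (T x) = norm x" "surj T" and bcp: "ball_covering_property TYPE('a)"
  shows "ball_covering_property TYPE('b)"
proof -
  obtain z :: "nat \<Rightarrow> 'a" and r where zr: "\<And>n. z n \<noteq> 0 \<and> 0 < r n \<and> r n \<le> norm (z n)"
    and cover: "sphere 0 1 \<subseteq> (\<Union>n. ball (z n) (r n))"
    using bcp unfolding ball_covering_property_def by blast
  have dist_T: "dist (T x) (T y) = dist x y" for x y
    by (simp add: dist_norm T(2) flip: linear_diff[OF T(1)])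
  show ?thesis
    unfolding ball_covering_property_def
  proof (intro exI conjI allI)
    fix n
    show "T (z n) \<noteq> 0" "0 < r n" "r n \<le> norm (T (z n))"
      using zr[of n] T(2)[of "z n"] by auto
  next
    show "sphere 0 1 \<subseteq> (\<Union>n. ball (T (z n)) (r n))"
    proof
      fix u :: 'b assume u: "u \<in> sphere 0 1"
      obtain x where x: "u = T x" using T(3) by (metis surjD)
      then have "x \<in> sphere 0 1" using u T(2)[of x] by simp
      then have "x \<in> (\<Union>n. ball (z n) (r n))" by (rule subsetD[OF cover])
      then show "u \<in> (\<Union>n. ball (T (z n)) (r n))" by (auto simp: x dist_T)
    qed
  qed
qed

text \<open>On a slice of \<open>\<phi>\<close> at \<open>x\<close> the functional \<open>f\<close> exceeds \<open>f x / 2\<close>, so \<open>k \<phi> - f\<close> stays below \<open>k - f x / 2\<close> there. Off the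
slice \<open>k \<phi>\<close> is at most \<open>k - 2\<close> for large \<open>k\<close>, and \<open>- f\<close> adds at most \<open>1\<close>.\<close>
lemma exposing_multiple_close:
  fixes \<phi> f :: "'x::real_normed_vector \<Rightarrow>\<^sub>L real"
  assumes \<phi>: "norm \<phi> = 1" and f: "norm f = 1" and fx: "blinfun_apply f x > 0"
    and exposes: "\<And>X :: nat \<Rightarrow> 'x. range X \<subseteq> cball 0 1 \<Longrightarrow> (\<lambda>n. blinfun_apply \<phi> (X n)) \<longlonglongrightarrow> 1 \<Longrightarrow> X \<longlonglongrightarrow> x"
  obtains k :: nat where "k > 0" "norm (real k *\<^sub>R \<phi> - f) < real k"
proof -
  let ?a = "blinfun_apply f x"
  have "\<exists>\<delta>>0. \<forall>y. norm y \<le> 1 \<longrightarrow> 1 - \<delta> < blinfun_apply \<phi> y \<longrightarrow> ?a / 2 < blinfun_apply f y"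
  proof (rule ccontr)
    assume contr: "\<not> ?thesis"
    have "\<exists>y. norm y \<le> 1 \<and> 1 - inverse (real (Suc n)) < blinfun_apply \<phi> y \<and> blinfun_apply f y \<le> ?a / 2" for n
    proof -
      have "inverse (real (Suc n)) > 0" by simp
      then show ?thesis using contr by (meson not_le)
    qed
    then obtain X where X: "\<And>n. norm (X n) \<le> 1" "\<And>n. 1 - inverse (real (Suc n)) < blinfun_apply \<phi> (X n)"
      "\<And>n. blinfun_apply f (X n) \<le> ?a / 2"
      by metis
    have "(\<lambda>n. blinfun_apply \<phi> (X n)) \<longlonglongrightarrow> 1"
    proof (rule tendsto_sandwich)
      show "\<forall>\<^sub>F n in sequentially. 1 - inverse (real (Suc n)) \<le> blinfun_apply \<phi> (X n)"
        using X(2) by (intro always_eventually allI less_imp_le)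
      show "\<forall>\<^sub>F n in sequentially. blinfun_apply \<phi> (X n) \<le> 1"
        using blinfun_le_norm(1)[OF X(1), of \<phi>] \<phi> by (intro always_eventually allI) simp
      show "(\<lambda>n. 1 - inverse (real (Suc n))) \<longlonglongrightarrow> 1"
        using tendsto_diff[OF tendsto_const LIMSEQ_inverse_real_of_nat, of 1] by simp
    qed simp
    then have "X \<longlonglongrightarrow> x" using X(1) by (intro exposes) auto
    then have "(\<lambda>n. blinfun_apply f (X n)) \<longlonglongrightarrow> ?a" by (intro tendsto_intros)
    then have "?a \<le> ?a / 2" by (rule LIMSEQ_le_const2) (use X(3) in blast)
    then show False using fx by simp
  qed
  then obtain \<delta> where \<delta>: "\<delta> > 0"
    "\<And>y. norm y \<le> 1 \<Longrightarrow> 1 - \<delta> < blinfun_apply \<phi> y \<Longrightarrow> ?a / 2 < blinfun_apply f y"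
    by blast
  obtain k :: nat where "2 / \<delta> < real k" using reals_Archimedean2 by blast
  then have k: "2 < real k * \<delta>" using \<delta>(1) by (simp add: field_simps)
  then have k_pos: "k > 0" by (cases "k = 0") auto
  let ?m = "min (?a / 2) 1"
  have "norm (real k *\<^sub>R \<phi> - f) \<le> real k - ?m"
  proof (rule norm_blinfun_le_ball)
    fix y :: 'x assume y: "norm y \<le> 1"
    have \<phi>y: "blinfun_apply \<phi> y \<le> 1" and fy: "- 1 \<le> blinfun_apply f y"
      using blinfun_le_norm[OF y] \<phi> f by metis+
    have "real k * blinfun_apply \<phi> y - blinfun_apply f y \<le> real k - ?m"
    proof (cases "1 - \<delta> < blinfun_apply \<phi> y")
      case True
      have "real k * blinfun_apply \<phi> y \<le> real k" using \<phi>y by (simp add: mult_left_le)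
      then show ?thesis using \<delta>(2)[OF y True] by linarith
    next
      case False
      then have "real k * blinfun_apply \<phi> y \<le> real k * (1 - \<delta>)" by (intro mult_left_mono) auto
      also have "\<dots> \<le> real k - 2" using k by (simp add: algebra_simps)
      finally show ?thesis using fy by linarith
    qed
    then show "blinfun_apply (real k *\<^sub>R \<phi> - f) y \<le> real k - ?m"
      by (simp add: blinfun.diff_left blinfun.scaleR_left)
  qed
  moreover have "?m > 0" using fx by simp
  ultimately show thesis using that[OF k_pos] by linarith
qed

definition separates_dual :: "'x::real_normed_vector set \<Rightarrow> bool" where
  "separates_dual D \<longleftrightarrow> (\<forall>f :: 'x \<Rightarrow>\<^sub>L real. (\<forall>x\<in>D. blinfun_apply f x = 0) \<longrightarrow> f = 0)"

text \<open>The centres are the nonzero integer multiples of the exposing functionals, and the radii are their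
norms. Negative multiples serve the functionals that are negative at the exposed point.\<close>
theorem strongly_exposed_separating_imp_ball_covering:
  fixes D :: "'x::real_normed_vector set"
  assumes D: "countable D" "\<And>x. x \<in> D \<Longrightarrow> strongly_exposed_point x" "separates_dual D"
    and nontrivial: "(f0 :: 'x \<Rightarrow>\<^sub>L real) \<noteq> 0"
  shows "ball_covering_property TYPE('x \<Rightarrow>\<^sub>L real)"
proof -
  have "\<forall>x\<in>D. \<exists>\<phi> :: 'x \<Rightarrow>\<^sub>L real. norm \<phi> = 1 \<and> (\<forall>X :: nat \<Rightarrow> 'x. range X \<subseteq> cball 0 1 \<longrightarrow>
      (\<lambda>n. blinfun_apply \<phi> (X n)) \<longlonglongrightarrow> 1 \<longrightarrow> X \<longlonglongrightarrow> x)"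
    using D(2) unfolding strongly_exposed_point_def by fastforce
  then obtain \<phi> :: "'x \<Rightarrow> 'x \<Rightarrow>\<^sub>L real" where \<phi>: "\<And>x. x \<in> D \<Longrightarrow> norm (\<phi> x) = 1"
    and exposes: "\<And>x X. x \<in> D \<Longrightarrow> range X \<subseteq> cball 0 1 \<Longrightarrow> (\<lambda>n::nat. blinfun_apply (\<phi> x) (X n)) \<longlonglongrightarrow> 1 \<Longrightarrow> X \<longlonglongrightarrow> x"
    by (auto dest!: bchoice)
  define A where "A = (\<lambda>(x, i). (real_of_int i *\<^sub>R \<phi> x, \<bar>real_of_int i\<bar>)) ` (D \<times> (UNIV - {0}))"
  show ?thesis
  proof (rule ball_covering_propertyI_countable)
    show "countable A" unfolding A_def using D(1) by (intro countable_image countable_SIGMA) auto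
    have "D \<noteq> {}" using D(3) nontrivial unfolding separates_dual_def by blast
    moreover have "(1::int) \<in> UNIV - {0}" by simp
    ultimately show "A \<noteq> {}" unfolding A_def by blast
    show "z \<noteq> 0 \<and> 0 < r \<and> r \<le> norm z" if "(z, r) \<in> A" for z r
      using that \<phi> by (force simp: A_def)
    fix f :: "'x \<Rightarrow>\<^sub>L real" assume f: "norm f = 1"
    have in_A: "(real_of_int i *\<^sub>R \<phi> x, \<bar>real_of_int i\<bar>) \<in> A" if "x \<in> D" "i \<noteq> 0" for x i
      unfolding A_def using that by force
    obtain x where x: "x \<in> D" "blinfun_apply f x \<noteq> 0"
      using D(3) f unfolding separates_dual_def by force
    show "\<exists>(z, r)\<in>A. dist z f < r"
    proof (cases "blinfun_apply f x > 0")
      case True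
      obtain k :: nat where k: "k > 0" "norm (real k *\<^sub>R \<phi> x - f) < real k"
        using exposing_multiple_close[OF \<phi>[OF x(1)] f True exposes[OF x(1)]] by metis
      then show ?thesis
        using in_A[OF x(1), of "int k"] by (intro bexI[of _ "(real k *\<^sub>R \<phi> x, real k)"]) (auto simp: dist_norm)
    next
      case False
      then have "blinfun_apply (- f) x > 0" "norm (- f) = 1" using x(2) f by (auto simp: blinfun.minus_left)
      then obtain k :: nat where k: "k > 0" "norm (real k *\<^sub>R \<phi> x - (- f)) < real k"
        using exposing_multiple_close[OF \<phi>[OF x(1)] _ _ exposes[OF x(1)]] by metis
      have "dist ((- real k) *\<^sub>R \<phi> x) f = norm (- (real k *\<^sub>R \<phi> x - (- f)))"
        by (simp add: dist_norm)
      then have "dist ((- real k) *\<^sub>R \<phi> x) f < real k" using k(2) by (simp only: norm_minus_cancel)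
      then show ?thesis
        using in_A[OF x(1), of "- int k"] k(1)
        by (intro bexI[of _ "((- real k) *\<^sub>R \<phi> x, real k)"]) auto
    qed
  qed
qed

text \<open>Suppose that a unit vector \<open>h\<close> lies in the ball about \<open>z n\<close>, so that \<open>h\<close> is closer to \<open>z n\<close> than \<open>0\<close> is. If
\<open>g\<close> is close enough to \<open>z n\<close> and attains its norm at \<open>x\<close>, the same holds for \<open>g\<close>, and then
\<open>h x \<ge> norm g - norm (g - h) > 0\<close>. It therefore suffices to collect the exposed points of a sequence
of strongly exposing functionals converging to each centre.\<close>
theorem ball_covering_imp_strongly_exposed_separating:
  assumes rnp: "radon_nikodym_property TYPE('x::banach)"
    and bcp: "ball_covering_property TYPE('x::banach \<Rightarrow>\<^sub>L real)"
    and nontrivial: "(u::'x::banach) \<noteq> 0"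
  obtains D :: "'x::banach set" where "countable D" "\<And>x. x \<in> D \<Longrightarrow> strongly_exposed_point x" "separates_dual D"
proof -
  obtain z :: "nat \<Rightarrow> 'x \<Rightarrow>\<^sub>L real" and r where r: "\<And>n. r n \<le> norm (z n)"
    and cover: "sphere 0 1 \<subseteq> (\<Union>n. ball (z n) (r n))"
    using bcp unfolding ball_covering_property_def by blast
  have "\<exists>g x. dist (z n) g < inverse (real (Suc k)) \<and> strongly_exposed_point x \<and> blinfun_apply g x = norm g" for n k
    using dense_strongly_exposing[OF rnp nontrivial, of "inverse (real (Suc k))" "z n"] by fastforce
  then obtain g x where g: "\<And>n k. dist (z n) (g n k) < inverse (real (Suc k))"
    and x: "\<And>n k. strongly_exposed_point (x n k)" "\<And>n k. blinfun_apply (g n k) (x n k) = norm (g n k)"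
    by metis
  define D where "D = range (\<lambda>(n, k). x n k)"
  have sep: "\<exists>y\<in>D. blinfun_apply f y \<noteq> 0" if f: "f \<noteq> 0" for f :: "'x \<Rightarrow>\<^sub>L real"
  proof -
    define h where "h = (1 / norm f) *\<^sub>R f"
    have "h \<in> sphere 0 1" using f by (simp add: h_def)
    then have "h \<in> (\<Union>n. ball (z n) (r n))" by (rule subsetD[OF cover])
    then obtain n where n: "dist (z n) h < r n" by auto
    then have "0 < (norm (z n) - dist (z n) h) / 2" using r[of n] by simp
    then obtain k where k: "inverse (real (Suc k)) < (norm (z n) - dist (z n) h) / 2"
      using reals_Archimedean by blast
    have "norm (x n k) \<le> 1" using x(1)[of n k] by (simp add: strongly_exposed_point_def)
    then have "blinfun_apply (g n k - h) (x n k) \<le> norm (g n k - h)"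
      by (rule blinfun_le_norm(1))
    then have 1: "norm (g n k) - dist (g n k) h \<le> blinfun_apply h (x n k)"
      by (simp add: blinfun.diff_left x(2) dist_norm)
    have 2: "dist (g n k) h \<le> dist (z n) (g n k) + dist (z n) h"
      by (metis dist_commute dist_triangle)
    have 3: "norm (z n) - dist (z n) (g n k) \<le> norm (g n k)"
      using norm_triangle_ineq2[of "z n" "g n k"] by (simp add: dist_norm)
    have "2 * dist (z n) (g n k) < norm (z n) - dist (z n) h"
      using order.strict_trans[OF g[of n k] k] by (simp add: field_simps)
    with 1 2 3 have "0 < blinfun_apply h (x n k)" by linarith
    then have "blinfun_apply f (x n k) \<noteq> 0" by (auto simp: h_def blinfun.scaleR_left)
    then show ?thesis unfolding D_def by force
  qed
  show thesis
  proof (rule that)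
    show "countable D" by (simp add: D_def)
    show "strongly_exposed_point y" if "y \<in> D" for y using that x(1) by (auto simp: D_def)
    show "separates_dual D" unfolding separates_dual_def using sep by blast
  qed
qed

section \<open>Lipschitz functions as the dual of the Lipschitz-free space\<close>

lift_definition free_pairing :: "'a::{metric_space, zero} lip0 \<Rightarrow> 'a lip_free \<Rightarrow>\<^sub>L real"
  is "\<lambda>f \<mu>. blinfun_apply (free_functional \<mu>) f"
proof (rule bounded_linear_intro)
  fix f :: "'a lip0" and \<mu> :: "'a lip_free"
  show "norm (blinfun_apply (free_functional \<mu>) f) \<le> norm \<mu> * norm f"
    using norm_blinfun[of "free_functional \<mu>" f] by (simp add: norm_lip_free.rep_eq)
qed (simp_all add: plus_lip_free.rep_eq scaleR_lip_free.rep_eq blinfun.add_left blinfun.scaleR_left)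

lift_definition free_delta :: "'a::{metric_space, zero} \<Rightarrow> 'a lip_free" is lip_delta
  by (rule subsetD[OF closure_subset]) (simp add: span_base)

lemma free_pairing_delta: "blinfun_apply (free_pairing f) (free_delta t) = lip_apply f t"
  by (simp add: free_pairing.rep_eq free_delta.rep_eq lip_delta.rep_eq)

lemma free_delta_0: "free_delta 0 = 0"
  by transfer (auto intro!: blinfun_eqI simp: lip_delta.rep_eq)

lemma norm_free_delta_diff_le: "norm (free_delta t - free_delta s) \<le> dist t s"
  unfolding norm_lip_free.rep_eq minus_lip_free.rep_eq free_delta.rep_eq
proof (rule norm_blinfun_bound)
  show "norm (blinfun_apply (lip_delta t - lip_delta s) f) \<le> dist t s * norm f" for f :: "'a lip0"
    using lip_apply_diff_le[of f t s] by (simp add: blinfun.diff_left lip_delta.rep_eq mult.commute)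
qed simp

lemma linear_free_pairing: "linear free_pairing"
  by (intro linearI blinfun_eqI)
    (simp_all add: free_pairing.rep_eq blinfun.add_right blinfun.scaleR_right blinfun.add_left blinfun.scaleR_left)

lemma norm_free_pairing: "norm (free_pairing f) = norm f"
proof (rule antisym)
  show "norm (free_pairing f) \<le> norm f"
  proof (rule norm_blinfun_bound)
    show "norm (blinfun_apply (free_pairing f) \<mu>) \<le> norm f * norm \<mu>" for \<mu>
      using norm_blinfun[of "free_functional \<mu>" f]
      by (simp add: free_pairing.rep_eq norm_lip_free.rep_eq mult.commute)
  qed simp
  show "norm f \<le> norm (free_pairing f)"
  proof (rule norm_lip0_leI)
    fix t s
    have "\<bar>lip_apply f t - lip_apply f s\<bar> = norm (blinfun_apply (free_pairing f) (free_delta t - free_delta s))"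
      by (simp add: blinfun.diff_right free_pairing_delta)
    also have "\<dots> \<le> norm (free_pairing f) * norm (free_delta t - free_delta s)" by (rule norm_blinfun)
    also have "\<dots> \<le> norm (free_pairing f) * dist t s"
      by (intro mult_left_mono norm_free_delta_diff_le) simp
    finally show "\<bar>lip_apply f t - lip_apply f s\<bar> \<le> norm (free_pairing f) * dist t s" .
  qed simp
qed

lemma closure_span_free_delta: "closure (span (range free_delta)) = (UNIV :: 'a::{metric_space, zero} lip_free set)"
proof -
  let ?F = "closure (span (range (lip_delta :: 'a \<Rightarrow> 'a lip0 \<Rightarrow>\<^sub>L real)))"
  have lin: "\<exists>\<mu>\<in>span (range free_delta). free_functional \<mu> = m" if "m \<in> span (range lip_delta)" for m :: "'a lip0 \<Rightarrow>\<^sub>L real"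
    using that
  proof (induction rule: span_induct_alt)
    case base
    show ?case by (intro bexI[of _ 0]) (auto simp: zero_lip_free.rep_eq span_zero)
  next
    case (step c x y)
    then obtain t \<mu> where "x = lip_delta t" "\<mu> \<in> span (range free_delta)" "free_functional \<mu> = y" by blast
    moreover have "c *\<^sub>R free_delta t + \<mu> \<in> span (range free_delta)"
      by (intro span_add span_scale) (auto simp: \<open>\<mu> \<in> span (range free_delta)\<close> intro: span_base)
    ultimately show ?case
      by (intro bexI[of _ "c *\<^sub>R free_delta t + \<mu>"])
        (auto simp: plus_lip_free.rep_eq scaleR_lip_free.rep_eq free_delta.rep_eq)
  qed
  have "\<mu> \<in> closure (span (range free_delta))" for \<mu> :: "'a lip_free"
    unfolding closure_approachable
  proof (intro allI impI)
    fix e :: real assume "e > 0"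
    then obtain m where "m \<in> span (range lip_delta)" "dist m (free_functional \<mu>) < e"
      using free_functional[of \<mu>] unfolding closure_approachable by blast
    then show "\<exists>\<nu>\<in>span (range free_delta). dist \<nu> \<mu> < e"
      using lin[of m] by (auto simp: dist_lip_free.rep_eq)
  qed
  then show ?thesis by blast
qed

text \<open>A functional on the free space is the pairing with its restriction to the point evaluations, as both
agree on their closed linear span.\<close>
lemma surj_free_pairing: "surj (free_pairing :: 'a::{metric_space, zero} lip0 \<Rightarrow> _)"
  unfolding surj_def
proof
  fix \<phi> :: "'a lip_free \<Rightarrow>\<^sub>L real"
  let ?f = "\<lambda>t. blinfun_apply \<phi> (free_delta t)"
  have "(norm \<phi>)-lipschitz_on UNIV ?f"
  proof (rule lipschitz_onI)
    fix t s :: 'a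
    have "dist (?f t) (?f s) = norm (blinfun_apply \<phi> (free_delta t - free_delta s))"
      by (simp add: dist_norm blinfun.diff_right)
    also have "\<dots> \<le> norm \<phi> * norm (free_delta t - free_delta s)" by (rule norm_blinfun)
    also have "\<dots> \<le> norm \<phi> * dist t s" by (intro mult_left_mono norm_free_delta_diff_le) simp
    finally show "dist (?f t) (?f s) \<le> norm \<phi> * dist t s" .
  qed simp
  then have f: "lip_apply (Abs_lip0 ?f) = ?f"
    by (intro Abs_lip0_inverse) (auto simp: free_delta_0)
  let ?Z = "{\<mu>. blinfun_apply (free_pairing (Abs_lip0 ?f)) \<mu> = blinfun_apply \<phi> \<mu>}"
  have "range free_delta \<subseteq> ?Z" by (auto simp: free_pairing_delta f)
  moreover have "subspace ?Z"
    by (rule subspaceI) (auto simp: blinfun.add_right blinfun.scaleR_right)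
  ultimately have "span (range free_delta) \<subseteq> ?Z" by (rule span_minimal)
  moreover have "closed ?Z" by (intro closed_Collect_eq continuous_intros)
  ultimately have "closure (span (range free_delta)) \<subseteq> ?Z" by (rule closure_minimal)
  then have "\<mu> \<in> ?Z" for \<mu> unfolding closure_span_free_delta by blast
  then have "\<phi> = free_pairing (Abs_lip0 ?f)" by (intro blinfun_eqI) simp
  then show "\<exists>f. \<phi> = free_pairing f" ..
qed

lemma separates_lip0_iff: "separates_lip0 D \<longleftrightarrow> separates_dual D"
proof -
  have zero: "free_pairing f = 0 \<longleftrightarrow> f = 0" for f :: "'a lip0"
    by (metis norm_free_pairing norm_eq_zero)
  have "separates_lip0 D \<longleftrightarrow> (\<forall>f. (\<forall>\<mu>\<in>D. blinfun_apply (free_pairing f) \<mu> = 0) \<longrightarrow> free_pairing f = 0)"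
    by (simp add: separates_lip0_def free_pairing.rep_eq zero)
  also have "\<dots> \<longleftrightarrow> separates_dual D"
    unfolding separates_dual_def using surj_free_pairing by (metis surjD)
  finally show ?thesis .
qed

lemma ball_covering_lip0_iff:
  "ball_covering_property TYPE('a::{metric_space, zero} lip0) \<longleftrightarrow>
    ball_covering_property TYPE('a::{metric_space, zero} lip_free \<Rightarrow>\<^sub>L real)"
proof
  let ?T = "free_pairing :: 'a lip0 \<Rightarrow> _"
  show "ball_covering_property TYPE('a lip_free \<Rightarrow>\<^sub>L real)" if "ball_covering_property TYPE('a lip0)"
    by (rule ball_covering_property_isometry[OF linear_free_pairing norm_free_pairing surj_free_pairing that])
  have inj: "inj ?T"
    unfolding linear_injective_0[OF linear_free_pairing] by (metis norm_free_pairing norm_eq_zero)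
  then have inv: "bij ?T" using surj_free_pairing by (simp add: bij_def)
  show "ball_covering_property TYPE('a lip0)" if "ball_covering_property TYPE('a lip_free \<Rightarrow>\<^sub>L real)"
  proof (rule ball_covering_property_isometry[OF _ _ _ that])
    show "linear (inv ?T)"
      by (intro linearI inv_f_eq[OF inj])
        (simp_all add: linear_add[OF linear_free_pairing] linear_scale[OF linear_free_pairing]
          surj_f_inv_f[OF surj_free_pairing])
    show "norm (inv ?T \<phi>) = norm \<phi>" for \<phi>
      by (metis norm_free_pairing surj_f_inv_f surj_free_pairing)
    show "surj (inv ?T)" using inv by (simp add: bij_imp_bij_inv bij_is_surj)
  qed
qed

text \<open>The distance to \<open>s\<close>, shifted to vanish at the base point, tells \<open>s\<close> from \<open>t\<close>.\<close>
lemma lip0_nontrivial: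
  assumes "(s::'a::{metric_space, zero}) \<noteq> t"
  obtains f :: "'a::{metric_space, zero} lip0" where "f \<noteq> 0"
proof -
  let ?g = "\<lambda>u. dist u s - dist 0 s"
  have "1-lipschitz_on UNIV ?g"
  proof (rule lipschitz_onI)
    show "dist (?g u) (?g w) \<le> 1 * dist u w" for u w
      using abs_dist_diff_le[of u s w] by (simp add: dist_real_def dist_commute)
  qed simp
  then have g: "lip_apply (Abs_lip0 ?g) = ?g" by (intro Abs_lip0_inverse) auto
  have "lip_apply (Abs_lip0 ?g) s \<noteq> lip_apply (Abs_lip0 ?g) t" using assms unfolding g by simp
  then have "Abs_lip0 ?g \<noteq> 0" by auto
  then show thesis by (rule that)
qed

theorem corollary3p17:
  assumes two_points: "\<exists>s t :: 'a::{metric_space, zero}. s \<noteq> t"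
  shows
    "((\<exists>D :: 'a lip_free set.
          countable D \<and> (\<forall>\<mu>\<in>D. strongly_exposed_point \<mu>) \<and> separates_lip0 D) \<longrightarrow>
        ball_covering_property TYPE('a lip0)) \<and>
     (radon_nikodym_property TYPE('a lip_free) \<longrightarrow>
        (ball_covering_property TYPE('a lip0) \<longleftrightarrow>
          (\<exists>D :: 'a lip_free set.
            countable D \<and> (\<forall>\<mu>\<in>D. strongly_exposed_point \<mu>) \<and> separates_lip0 D)))"
proof -
  obtain f :: "'a lip0" where "f \<noteq> 0" using two_points lip0_nontrivial by metis
  then have f: "free_pairing f \<noteq> 0" by (metis norm_free_pairing norm_eq_zero)
  then obtain \<mu> :: "'a lip_free" where \<mu>: "\<mu> \<noteq> 0" by (metis blinfun_eqI blinfun.zero_right zero_blinfun.rep_eq)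
  have i: "ball_covering_property TYPE('a lip0)"
    if "countable D" "\<forall>\<mu>\<in>D. strongly_exposed_point \<mu>" "separates_lip0 D" for D :: "'a lip_free set"
    unfolding ball_covering_lip0_iff
    using that by (intro strongly_exposed_separating_imp_ball_covering[OF _ _ _ f]) (auto simp: separates_lip0_iff)
  have ii: "\<exists>D :: 'a lip_free set. countable D \<and> (\<forall>\<mu>\<in>D. strongly_exposed_point \<mu>) \<and> separates_lip0 D"
    if "radon_nikodym_property TYPE('a lip_free)" "ball_covering_property TYPE('a lip0)"
    using ball_covering_imp_strongly_exposed_separating[OF that[unfolded ball_covering_lip0_iff] \<mu>]
    unfolding separates_lip0_iff by metis
  show ?thesis using i ii by blast
qed

end
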